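(* Let $A\in V$ be such that $[A]\in\mathcal E$ is a verge, with main conditions $\mathfrak p=\{(i_1,j_1),\ldots,(i_k,j_k)\}$. Put $a=\sum_{\nu=1}^k (i_\nu-j_\nu-1)$ and let $b$ be the number of hook intersections in $\Phi^+$ of the hooks $h_{i_\nu j_\nu}$, $\nu=1,\ldots,k$. Let $S$ be an irreducible constituent of the right $\mathbb C U$-module $\mathbb C\mathcal O_A^r$. Then $\dim_{\mathbb C} S\geqslant q^{a-b}$. Moreover, if $\dim_{\mathbb C} S=q^{a-b+m}$ for some $m\in\mathbb N=\{0,1,2,\ldots\}$, then the multiplicity of $S$ as a constituent of $\mathbb C\mathcal O_A^r$ is $q^m$.
   Context: Let $q$ be a power of a prime, $n$ a natural number, $U=U_n(q)$ the group of lower unitriangular $n\times n$ matrices over $\mathbb F_q$, and $V$ the additive group of strictly lower triangular $n\times n$ matrices over $\mathbb F_q$. Put $\Phi^+=\{(i,j): 1\leqslant j<i\leqslant n\}$. Fix a nontrivial character $\theta:(\mathbb F_q,+)\to\mathbb C^*$, and for $A\in V$ let $\chi_A:V\to\mathbb C^*$, $\chi_A(B)=\theta\big(\sum_{i,j}A_{ij}B_{ij}\big)$. For an $n\times n$ matrix $M$ let $\overline M\in V$ be obtained by setting all entries on and above the diagonal to zero; write $u^{-t}=(u^{-1})^t$. Let $\mathcal E=\{[A]: A\in V\}$ and let $\mathbb C\mathcal E$ be the $\mathbb C$-space with basis $\mathcal E$, made into a $\mathbb C U$-bimodule by $[A]u=\chi_A(1-u^{-1})\,[\overline{Au^{-t}}]$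 and $u[A]=\chi_A(1-u^{-1})\,[\overline{u^{-t}A}]$ for $u\in U$. (This bimodule is isomorphic to the regular bimodule $\mathbb C U$ via $[A]\mapsto \frac1{|U|}\sum_{u\in U}\overline{\chi_A(u-1)}\,u$, the bar here being complex conjugation.) Let $\mathcal O_A^r=\{[\overline{Au^{-t}}]:u\in U\}$; its span $\mathbb C\mathcal O_A^r=[A]\mathbb C U$ is a right $\mathbb C U$-module, whose character is an André–Yan supercharacter. $[A]\in\mathcal E$ is a verge if $A$ has at most one nonzero entry in each row and in each column; its main conditions are the positions of the nonzero entries of $A$. For $(i,j)\in\Phi^+$ the hook centered at $(i,j)$ is $h_{ij}=\{(i,k):j<k<i\}\cup\{(l,j):j<l<i\}\cup\{(i,j)\}$. A hook intersection is a position in $h_{ij}\cap h_{rs}$ for two distinct main conditions $(i,j),(r,s)$; it occurs exactly when (up to exchanging the two) $j<s<i<r$, and then $h_{ij}\cap h_{rs}=\{(i,s)\}$. *)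

theory Defs
  imports "Jordan_Normal_Form.Matrix" "HOL-Library.Function_Algebras" "HOL-Library.FuncSet"
    "HOL-Library.Cardinality"
begin

section \<open>Right modules over a complex group algebra\<close>

text \<open>A right module over the group algebra of \<open>G\<close> is encoded as a complex vector space with a
  linear right action of the group \<open>G\<close>; the action of the group algebra is its linear extension.
  The space is a linear subspace \<open>rcarrier M\<close> of an ambient vector space given by a whole type,
  so a submodule is obtained by replacing the field \<open>rcarrier\<close>.\<close>

record ('g, 'v) rmod =
  rcarrier :: "'v set"
  rscale :: "complex \<Rightarrow> 'v \<Rightarrow> 'v"
  ract :: "'v \<Rightarrow> 'g \<Rightarrow> 'v"

definition right_module :: "('g, 'x) monoid_scheme \<Rightarrow> ('g, 'v::ab_group_add) rmod \<Rightarrow> bool" where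
  "right_module G M \<longleftrightarrow>
     vector_space (rscale M) \<and> module.subspace (rscale M) (rcarrier M) \<and>
     (\<forall>v\<in>rcarrier M. \<forall>g\<in>carrier G. ract M v g \<in> rcarrier M) \<and>
     (\<forall>v\<in>rcarrier M. \<forall>w\<in>rcarrier M. \<forall>g\<in>carrier G.
        ract M (v + w) g = ract M v g + ract M w g) \<and>
     (\<forall>c. \<forall>v\<in>rcarrier M. \<forall>g\<in>carrier G. ract M (rscale M c v) g = rscale M c (ract M v g)) \<and>
     (\<forall>v\<in>rcarrier M. ract M v \<one>\<^bsub>G\<^esub> = v) \<and>
     (\<forall>v\<in>rcarrier M. \<forall>g\<in>carrier G. \<forall>h\<in>carrier G.
        ract M v (g \<otimes>\<^bsub>G\<^esub> h) = ract M (ract M v g) h)"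

definition rdim :: "('g, 'v::ab_group_add) rmod \<Rightarrow> nat" where
  "rdim M = vector_space.dim (rscale M) (rcarrier M)"

definition submodule_on ::
  "('g, 'x) monoid_scheme \<Rightarrow> ('g, 'v::ab_group_add) rmod \<Rightarrow> 'v set \<Rightarrow> bool" where
  "submodule_on G M N \<longleftrightarrow> N \<subseteq> rcarrier M \<and> right_module G (M\<lparr>rcarrier := N\<rparr>)"

definition irreducible_module ::
  "('g, 'x) monoid_scheme \<Rightarrow> ('g, 'v::ab_group_add) rmod \<Rightarrow> bool" where
  "irreducible_module G M \<longleftrightarrow>
     right_module G M \<and> rcarrier M \<noteq> {0} \<and>
     (\<forall>N. submodule_on G M N \<longrightarrow> N = {0} \<or> N = rcarrier M)"

definition module_iso :: "('g, 'x) monoid_scheme \<Rightarrow>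
    ('g, 'v::ab_group_add) rmod \<Rightarrow> ('g, 'w::ab_group_add) rmod \<Rightarrow> bool" where
  "module_iso G M N \<longleftrightarrow>
     (\<exists>f. bij_betw f (rcarrier M) (rcarrier N) \<and>
        (\<forall>v\<in>rcarrier M. \<forall>w\<in>rcarrier M. f (v + w) = f v + f w) \<and>
        (\<forall>c. \<forall>v\<in>rcarrier M. f (rscale M c v) = rscale N c (f v)) \<and>
        (\<forall>v\<in>rcarrier M. \<forall>g\<in>carrier G. f (ract M v g) = ract N (f v) g))"

text \<open>\<open>M\<close> is the internal direct sum of the irreducible submodules \<open>W 0, \<dots>, W (k - 1)\<close>:
  every element of \<open>M\<close> is in exactly one way a sum of elements of the \<open>W l\<close>.\<close>

definition decomposition :: "('g, 'x) monoid_scheme \<Rightarrow> ('g, 'v::ab_group_add) rmod \<Rightarrow>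
    nat \<Rightarrow> (nat \<Rightarrow> 'v set) \<Rightarrow> bool" where
  "decomposition G M k W \<longleftrightarrow>
     (\<forall>l<k. submodule_on G M (W l) \<and> irreducible_module G (M\<lparr>rcarrier := W l\<rparr>)) \<and>
     bij_betw (\<lambda>x. \<Sum>l<k. x l) (Pi\<^sub>E {..<k} W) (rcarrier M)"

definition irreducible_constituent :: "('g, 'x) monoid_scheme \<Rightarrow>
    ('g, 's::ab_group_add) rmod \<Rightarrow> ('g, 'v::ab_group_add) rmod \<Rightarrow> bool" where
  "irreducible_constituent G S M \<longleftrightarrow> irreducible_module G S \<and>
     (\<exists>k W. decomposition G M k W \<and> (\<exists>l<k. module_iso G S (M\<lparr>rcarrier := W l\<rparr>)))"

text \<open>The number of summands isomorphic to \<open>S\<close> in a decomposition of \<open>M\<close>; the definite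
  description only has a known value once this number is shown not to depend on the
  decomposition.\<close>

definition multiplicity_in :: "('g, 'x) monoid_scheme \<Rightarrow>
    ('g, 's::ab_group_add) rmod \<Rightarrow> ('g, 'v::ab_group_add) rmod \<Rightarrow> nat" where
  "multiplicity_in G S M =
     (THE r. \<exists>k W. decomposition G M k W \<and>
        r = card {l. l < k \<and> module_iso G S (M\<lparr>rcarrier := W l\<rparr>)})"


section \<open>Unitriangular groups and the orbit modules\<close>

text \<open>Rows and columns are numbered from \<open>0\<close> to \<open>n - 1\<close>.\<close>

definition unitriangular_group :: "nat \<Rightarrow> 'a::field mat monoid" where
  "unitriangular_group n =
     \<lparr>carrier = {u \<in> carrier_mat n n. (\<forall>i<n. u $$ (i, i) = 1) \<and>
                                     (\<forall>i<n. \<forall>j<n. i < j \<longrightarrow> u $$ (i, j) = 0)},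
      mult = (\<lambda>u v. u * v), one = 1\<^sub>m n\<rparr>"

definition strictly_lower :: "nat \<Rightarrow> 'a::field mat set" where
  "strictly_lower n = {A \<in> carrier_mat n n. \<forall>i<n. \<forall>j<n. i \<le> j \<longrightarrow> A $$ (i, j) = 0}"

definition lower_part :: "'a::field mat \<Rightarrow> 'a mat" where
  "lower_part M = mat (dim_row M) (dim_col M) (\<lambda>(i, j). if j < i then M $$ (i, j) else 0)"

definition nontrivial_character :: "('a::field \<Rightarrow> complex) \<Rightarrow> bool" where
  "nontrivial_character \<theta> \<longleftrightarrow>
     (\<forall>x. \<theta> x \<noteq> 0) \<and> (\<forall>x y. \<theta> (x + y) = \<theta> x * \<theta> y) \<and> (\<exists>x. \<theta> x \<noteq> 1)"

definition chi :: "('a::field \<Rightarrow> complex) \<Rightarrow> 'a mat \<Rightarrow> 'a mat \<Rightarrow> complex" where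
  "chi \<theta> A B = \<theta> (\<Sum>i<dim_row A. \<Sum>j<dim_col A. A $$ (i, j) * B $$ (i, j))"

text \<open>The space with basis \<open>{[A]. A \<in> V}\<close> is realised as the span of the point functions
  \<open>[A] = basis_elt A\<close> inside the space of all complex functions on matrices.\<close>

definition basis_elt :: "'a mat \<Rightarrow> 'a mat \<Rightarrow> complex" where
  "basis_elt A = (\<lambda>B. if B = A then 1 else 0)"

definition fun_scale :: "complex \<Rightarrow> ('b \<Rightarrow> complex) \<Rightarrow> ('b \<Rightarrow> complex)" where
  "fun_scale c f = (\<lambda>x. c * f x)"

text \<open>The product \<open>A * u\<^sup>-\<^sup>t\<close> truncated to its strictly lower part, so that
  \<open>[A]u = chi \<theta> A (1 - u\<^sup>-\<^sup>1) [dot_act n A u]\<close>.\<close>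

definition dot_act :: "nat \<Rightarrow> 'a::field mat \<Rightarrow> 'a mat \<Rightarrow> 'a mat" where
  "dot_act n A u = lower_part (A * transpose_mat (inv\<^bsub>unitriangular_group n\<^esub> u))"

definition E_module ::
  "nat \<Rightarrow> ('a::{field, finite} \<Rightarrow> complex) \<Rightarrow> ('a mat, 'a mat \<Rightarrow> complex) rmod" where
  "E_module n \<theta> =
     \<lparr>rcarrier = module.span fun_scale (basis_elt ` strictly_lower n),
      rscale = fun_scale,
      ract = (\<lambda>f u. \<Sum>A\<in>strictly_lower n.
                fun_scale (f A * chi \<theta> A (1\<^sub>m n - inv\<^bsub>unitriangular_group n\<^esub> u))
                  (basis_elt (dot_act n A u)))\<rparr>"

definition right_orbit :: "nat \<Rightarrow> 'a::field mat \<Rightarrow> ('a mat \<Rightarrow> complex) set" where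
  "right_orbit n A = {basis_elt (dot_act n A u) | u. u \<in> carrier (unitriangular_group n)}"

definition orbit_module :: "nat \<Rightarrow> ('a::{field, finite} \<Rightarrow> complex) \<Rightarrow> 'a mat \<Rightarrow>
    ('a mat, 'a mat \<Rightarrow> complex) rmod" where
  "orbit_module n \<theta> A = (E_module n \<theta>)\<lparr>rcarrier := module.span fun_scale (right_orbit n A)\<rparr>"


section \<open>Verges and hooks\<close>

definition verge :: "'a::field mat \<Rightarrow> bool" where
  "verge A \<longleftrightarrow>
     (\<forall>i<dim_row A. card {j. j < dim_col A \<and> A $$ (i, j) \<noteq> 0} \<le> 1) \<and>
     (\<forall>j<dim_col A. card {i. i < dim_row A \<and> A $$ (i, j) \<noteq> 0} \<le> 1)"

definition main_conditions :: "'a::field mat \<Rightarrow> (nat \<times> nat) set" where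
  "main_conditions A = {(i, j). i < dim_row A \<and> j < dim_col A \<and> A $$ (i, j) \<noteq> 0}"

definition Phi_plus :: "nat \<Rightarrow> (nat \<times> nat) set" where
  "Phi_plus n = {(i, j). j < i \<and> i < n}"

definition hook :: "nat \<times> nat \<Rightarrow> (nat \<times> nat) set" where
  "hook p = (case p of (i, j) \<Rightarrow>
     {(i, k) | k. j < k \<and> k < i} \<union> {(l, j) | l. j < l \<and> l < i} \<union> {(i, j)})"

definition hook_intersections :: "nat \<Rightarrow> (nat \<times> nat) set \<Rightarrow> (nat \<times> nat) set" where
  "hook_intersections n P =
     {x \<in> Phi_plus n. \<exists>p\<in>P. \<exists>p'\<in>P. p \<noteq> p' \<and> x \<in> hook p \<inter> hook p'}"

end

(* For B in V let H_B be the stabilizer of [B] under the right action and psi_B the linear character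
   u |-> chi_B(1 - u^-1) by which it acts on [B]; the pair (H_B, psi_B) depends only on the left orbit
   of B.  The module spanned by the right orbit of B is cyclic on [B], so its homomorphisms to S
   correspond to the psi_B-weight vectors of H_B in S, and by Schur's lemma the number of summands
   of C O_A isomorphic to S is the dimension r of the psi_A-weight space of S.
   On the other hand, the images f_B of the [B] in the group algebra split S into one copy of the
   psi_B-weight space for each right orbit.  By Fourier inversion on V this space vanishes unless B
   lies in the biorbit of A, and every right orbit in the biorbit has a representative in the left
   orbit of A.  Hence dim S = N r, where N is the number of right orbits meeting the left orbit
   of A.  For a verge the left orbit fills the vertical legs of the hooks and the right orbit the
   horizontal ones, freely, so N = q^a / q^b. *)

theory Submission
  imports Defs "HOL-Computational_Algebra.Fundamental_Theorem_Algebra" "Jordan_Normal_Form.Determinant"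
begin

section \<open>Modules and Schur's lemma\<close>

text \<open>The bijection u |-> u - 1 from U to V turns sums over the group into sums of additive
  characters of V, evaluated by one orthogonality relation for \<open>pairing\<close>; the
  truncations disappear under that pairing. The splitting of S is made explicit by operators
  \<open>F B\<close> for [B] and \<open>F_adj B\<close> for the adjoint: \<open>F C\<close> after
  \<open>F_adj B\<close> vanishes when B and C lie in different right orbits, and for B = C it is
  the scalar |V| |H_B| on the psi_B-weight space. The representatives i of the right orbits are
  taken in the left orbit of A so that they all share one weight space; a single basis
  \<open>s l\<close> of it then yields the basis \<open>F_adj i (s l)\<close> of S. The delicate
  point is that nothing of S escapes these finitely many i, and this is where the embedding of S
  into C O_A enters. The equality dim S = N r is proved for an arbitrary decomposition of C O_A; as
  N is positive, it shows at the same time that r is the same for all decompositions, which gives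
  meaning to the definite description in \<open>multiplicity_in\<close>.\<close>

lemma (in vector_space) dim_eq_card_family:
  assumes fin: "finite J" and X: "subspace X" and v: "\<And>j. j \<in> J \<Longrightarrow> v j \<in> X"
    and ind: "\<And>c. (\<Sum>j\<in>J. scale (c j) (v j)) = 0 \<Longrightarrow> \<forall>j\<in>J. c j = 0"
    and sp: "\<And>x. x \<in> X \<Longrightarrow> \<exists>c. x = (\<Sum>j\<in>J. scale (c j) (v j))"
  shows "dim X = card J"
proof -
  \<comment> \<open>Two equal members of the family would satisfy a relation with coefficients 1 and
    -1, so independence in the sense of families forces injectivity; only then can the family be
    traded for the set of its values.\<close>
  have inj: "inj_on v J"
  proof (rule inj_onI, rule ccontr)
    fix i j assume ij: "i \<in> J" "j \<in> J" "v i = v j" "i \<noteq> j"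
    let ?c = "\<lambda>k. if k = i then 1 else if k = j then -1 else 0"
    have "(\<Sum>k\<in>J. scale (?c k) (v k)) = (\<Sum>k\<in>{i,j}. scale (?c k) (v k))"
      using ij fin by (intro sum.mono_neutral_right) auto
    also have "\<dots> = 0" using ij by simp
    finally show False using ind[of ?c] ij by auto
  qed
  have "independent (v ` J)"
  proof
    assume "dependent (v ` J)"
    then obtain u y where u: "y \<in> v ` J" "u y \<noteq> 0" "(\<Sum>w\<in>v ` J. scale (u w) w) = 0"
      using fin by (auto simp: dependent_finite)
    have "(\<Sum>j\<in>J. scale (u (v j)) (v j)) = 0"
      using u(3) by (simp add: sum.reindex[OF inj])
    then show False using ind[of "u \<circ> v"] u by auto
  qed
  moreover have "span (v ` J) = X"
  proof
    show "span (v ` J) \<subseteq> X" using v by (intro span_minimal X) auto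
    show "X \<subseteq> span (v ` J)"
    proof
      fix x assume "x \<in> X"
      then obtain c where "x = (\<Sum>j\<in>J. scale (c j) (v j))" using sp by blast
      then show "x \<in> span (v ` J)" by (auto intro: span_sum span_scale span_base)
    qed
  qed
  ultimately have "dim X = card (v ` J)"
    by (intro dim_eq_card) (auto simp: span_eq_iff[THEN iffD2, OF X])
  then show ?thesis by (simp add: card_image[OF inj])
qed

text \<open>Take a polynomial p of least degree with p(T) x0 = 0 and write p = (X - z) r. Then r(T)
  x0 is nonzero by minimality and is killed by T - z. Linearity of T is available on X only, so
  everything stays inside X.\<close>

lemma exists_eigenvector:
  fixes scale :: "complex \<Rightarrow> 'v::ab_group_add \<Rightarrow> 'v"
  assumes "vector_space scale" and X: "module.subspace scale X"
    and B: "finite B" "X \<subseteq> module.span scale B"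
    and TX: "\<And>x. x \<in> X \<Longrightarrow> T x \<in> X"
    and Tadd: "\<And>x y. x \<in> X \<Longrightarrow> y \<in> X \<Longrightarrow> T (x + y) = T x + T y"
    and Tsc: "\<And>c x. x \<in> X \<Longrightarrow> T (scale c x) = scale c (T x)"
    and x0: "x0 \<in> X" "x0 \<noteq> 0"
  obtains l x where "x \<in> X" "x \<noteq> 0" "T x = scale l x"
proof -
  interpret vector_space scale by fact
  define v where "v = (\<lambda>i::nat. (T ^^ i) x0)"
  have vX: "v i \<in> X" for i by (induction i) (auto simp: v_def x0 TX)
  have Tv: "T (v i) = v (Suc i)" for i by (simp add: v_def)
  have Tsum: "T (\<Sum>i\<in>I. scale (c i) (v i)) = (\<Sum>i\<in>I. scale (c i) (v (Suc i)))" if "finite I" for I c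
    using that
  proof (induction I)
    case empty
    have "T 0 = 0" using Tsc[of 0 0] subspace_0[OF X] by simp
    then show ?case by simp
  next
    case (insert a I)
    have "(\<Sum>i\<in>I. scale (c i) (v i)) \<in> X"
      by (intro subspace_sum X subspace_scale vX)
    then show ?case using insert by (simp add: Tadd Tsc vX subspace_scale[OF X] Tv)
  qed
  \<comment> \<open>\<open>ev d p\<close> is p(T) applied to x0, cut off at degree d. With d fixed
    it is linear in p without comparing degrees, and \<open>evd\<close> says that every cutoff from
    the degree on gives the same value.\<close>
  define ev where "ev = (\<lambda>d p. \<Sum>i\<le>d::nat. scale (poly.coeff p i) (v i))"
  have evadd: "ev d (p + r) = ev d p + ev d r" for d p r
    by (simp add: ev_def sum.distrib scale_left_distrib)
  have evsm: "ev d (Polynomial.smult c p) = scale c (ev d p)" for d c p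
    by (simp add: ev_def scale_sum_right)
  have evd: "ev d p = ev (degree p) p" if "d \<ge> degree p" for d p
    unfolding ev_def using that by (intro sum.mono_neutral_right) (auto simp: coeff_eq_0)
  have evX: "ev d p \<in> X" for d p
    unfolding ev_def by (intro subspace_sum X subspace_scale vX)
  \<comment> \<open>\<open>dependent\<close> is a property of sets, so a repetition in the sequence
    T^i x0 is a case of its own, in which X^j - X^i annihilates x0. Without repetition, an infinite
    set inside a finitely generated span is dependent, and the coefficients of a relation form the
    polynomial.\<close>
  have ex: "\<exists>p. p \<noteq> 0 \<and> ev (degree p) p = 0"
  proof (cases "inj v")
    case False
    then obtain i j where ij: "i < j" "v i = v j"
      by (metis injI linorder_neqE_nat)
    let ?p = "monom 1 j + monom (-1) i :: complex poly"
    have c: "poly.coeff ?p k = (if k = j then 1 else if k = i then -1 else 0)" for k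
      using ij by auto
    have "ev j ?p = (\<Sum>k\<in>{i,j}. scale (poly.coeff ?p k) (v k))"
      unfolding ev_def using ij by (intro sum.mono_neutral_right) (auto simp: c)
    also have "\<dots> = 0" using ij by (simp add: c)
    finally have "ev j ?p = 0" .
    moreover have "degree ?p \<le> j" by (rule degree_le) (use ij in \<open>auto simp: c\<close>)
    moreover have "?p \<noteq> 0" using c[of j] by (metis coeff_0 zero_neq_one)
    ultimately show ?thesis using evd by metis
  next
    case True
    have "range v \<subseteq> span B" using vX B by auto
    moreover have "infinite (range v)" using True by (simp add: finite_image_iff)
    ultimately have "dependent (range v)"
      using independent_span_bound[OF B(1)] by blast
    then obtain S u y where S: "finite S" "S \<subseteq> range v" "(\<Sum>w\<in>S. scale (u w) w) = 0" "y \<in> S" "u y \<noteq> 0"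
      by (auto simp: dependent_explicit)
    obtain I where I: "finite I" "S = v ` I" using finite_subset_image[OF S(1,2)] by auto
    let ?p = "(\<Sum>i\<in>I. monom (u (v i)) i) :: complex poly"
    have c: "poly.coeff ?p k = (if k \<in> I then u (v k) else 0)" for k
      using I(1) by (simp add: coeff_sum)
    define d where "d = Max (insert 0 I)"
    have Id: "I \<subseteq> {..d}" using I(1) by (auto simp: d_def)
    have "ev d ?p = (\<Sum>k\<in>I. scale (u (v k)) (v k))"
      unfolding ev_def using Id by (intro sum.mono_neutral_cong_right) (auto simp: c)
    also have "\<dots> = 0" using S(3) I True by (simp add: sum.reindex inj_on_subset)
    finally have "ev d ?p = 0" .
    moreover have "degree ?p \<le> d" by (rule degree_le) (use Id in \<open>auto simp: c\<close>)
    moreover obtain k where "k \<in> I" "y = v k" using S I by auto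
    then have "?p \<noteq> 0" using c[of k] S(5) by (metis coeff_0)
    ultimately show ?thesis using evd by metis
  qed
  define p where "p = (ARG_MIN degree p. p \<noteq> 0 \<and> ev (degree p) p = 0)"
  have p: "p \<noteq> 0" "ev (degree p) p = 0"
    and min: "\<And>r. r \<noteq> 0 \<Longrightarrow> ev (degree r) r = 0 \<Longrightarrow> degree p \<le> degree r"
    using arg_min_nat_lemma[of "\<lambda>p. p \<noteq> 0 \<and> ev (degree p) p = 0" _ degree] ex
    unfolding p_def by blast+
  have "degree p \<noteq> 0"
  proof
    assume "degree p = 0"
    then obtain a where "p = [:a:]" by (metis degree_0_id)
    then show False using p x0 by (auto simp: ev_def v_def)
  qed
  then obtain z where "poly p z = 0"
    using fundamental_theorem_of_algebra constant_degree by metis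
  then obtain r where r: "p = [:- z, 1:] * r" by (metis poly_eq_0_iff_dvd dvdE)
  have r0: "r \<noteq> 0" using p r by auto
  have dp: "degree p = Suc (degree r)" unfolding r using r0 by (subst degree_mult_eq) auto
  define x where "x = ev (degree r) r"
  have "x \<noteq> 0" unfolding x_def using min[OF r0] dp by auto
  moreover have "x \<in> X" unfolding x_def by (rule evX)
  moreover have "T x = scale z x"
  proof -
    \<comment> \<open>\<open>pCons 0 r\<close> is X r, and shifting the coefficients by one amounts
      to applying T; hence p(T) x0 = 0 reads T x - z x = 0.\<close>
    have "p = pCons 0 r + Polynomial.smult (-z) r" unfolding r by simp
    then have "0 = ev (Suc (degree r)) (pCons 0 r) + scale (-z) (ev (Suc (degree r)) r)"
      using p(2) dp evadd evsm by metis
    moreover have "ev (Suc (degree r)) (pCons 0 r) = T x"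
      unfolding x_def ev_def by (subst Tsum) (simp_all add: sum.atMost_Suc_shift del: sum.atMost_Suc)
    moreover have "ev (Suc (degree r)) r = x" using evd[of r "Suc (degree r)"] by (simp add: x_def)
    ultimately show ?thesis by simp
  qed
  ultimately show ?thesis using that by blast
qed

text \<open>All conditions are restricted to the carrier, since a module is a subspace of an ambient
  type and its action is controlled only there.\<close>

definition rmod_hom :: "('g, 'x) monoid_scheme \<Rightarrow>
    ('g, 'v::ab_group_add) rmod \<Rightarrow> ('g, 'w::ab_group_add) rmod \<Rightarrow> ('v \<Rightarrow> 'w) \<Rightarrow> bool" where
  "rmod_hom G M N f \<longleftrightarrow> f ` rcarrier M \<subseteq> rcarrier N \<and>
     (\<forall>v\<in>rcarrier M. \<forall>w\<in>rcarrier M. f (v + w) = f v + f w) \<and>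
     (\<forall>c. \<forall>v\<in>rcarrier M. f (rscale M c v) = rscale N c (f v)) \<and>
     (\<forall>v\<in>rcarrier M. \<forall>g\<in>carrier G. f (ract M v g) = ract N (f v) g)"

locale right_mod = group G for G (structure) +
  fixes M :: "('a, 'v::ab_group_add) rmod"
  assumes right_module: "right_module G M"
begin

sublocale vector_space "rscale M"
  using right_module by (simp add: right_module_def)

lemma subspace_carrier: "subspace (rcarrier M)"
  using right_module by (simp add: right_module_def)

lemma act_closed: "v \<in> rcarrier M \<Longrightarrow> g \<in> carrier G \<Longrightarrow> ract M v g \<in> rcarrier M"
  and act_add: "v \<in> rcarrier M \<Longrightarrow> w \<in> rcarrier M \<Longrightarrow> g \<in> carrier G \<Longrightarrow>
    ract M (v + w) g = ract M v g + ract M w g"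
  and act_scale: "v \<in> rcarrier M \<Longrightarrow> g \<in> carrier G \<Longrightarrow>
    ract M (rscale M c v) g = rscale M c (ract M v g)"
  and act_one: "v \<in> rcarrier M \<Longrightarrow> ract M v \<one> = v"
  and act_mult: "v \<in> rcarrier M \<Longrightarrow> g \<in> carrier G \<Longrightarrow> h \<in> carrier G \<Longrightarrow>
    ract M v (g \<otimes> h) = ract M (ract M v g) h"
  using right_module by (simp_all add: right_module_def)

lemma zero_closed: "0 \<in> rcarrier M"
  and add_closed: "v \<in> rcarrier M \<Longrightarrow> w \<in> rcarrier M \<Longrightarrow> v + w \<in> rcarrier M"
  and scale_closed: "v \<in> rcarrier M \<Longrightarrow> rscale M c v \<in> rcarrier M"
  and sum_closed: "(\<And>i. i \<in> I \<Longrightarrow> x i \<in> rcarrier M) \<Longrightarrow> sum x I \<in> rcarrier M"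
  using subspace_carrier by (auto intro: subspace_0 subspace_add subspace_scale subspace_sum)

lemma act_zero: "g \<in> carrier G \<Longrightarrow> ract M 0 g = 0"
  using act_scale[of 0 g 0] zero_closed by simp

lemma act_sum:
  assumes "\<And>i. i \<in> I \<Longrightarrow> x i \<in> rcarrier M" "g \<in> carrier G"
  shows "ract M (\<Sum>i\<in>I. x i) g = (\<Sum>i\<in>I. ract M (x i) g)"
  using assms
proof (induction I rule: infinite_finite_induct)
  case (insert a I)
  have "sum x I \<in> rcarrier M" using insert.prems by (intro sum_closed) auto
  then show ?case using insert by (simp add: act_add)
qed (simp_all add: act_zero)

lemma submodule_onI:
  assumes "N \<subseteq> rcarrier M" "subspace N"
    and "\<And>v g. v \<in> N \<Longrightarrow> g \<in> carrier G \<Longrightarrow> ract M v g \<in> N"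
  shows "submodule_on G M N"
  using assms right_module unfolding submodule_on_def right_module_def
  by (auto simp: subset_iff)

lemma hom_zero:
  assumes "rmod_hom G M N f" "vector_space (rscale N)" shows "f 0 = 0"
proof -
  interpret N: vector_space "rscale N" by fact
  have "f (rscale M 0 0) = rscale N 0 (f 0)"
    using assms zero_closed unfolding rmod_hom_def by blast
  then show ?thesis by simp
qed

lemma hom_sum:
  assumes "rmod_hom G M N f" "vector_space (rscale N)" "\<And>i. i \<in> I \<Longrightarrow> x i \<in> rcarrier M"
  shows "f (\<Sum>i\<in>I. x i) = (\<Sum>i\<in>I. f (x i))"
  using assms(3)
proof (induction I rule: infinite_finite_induct)
  case (insert a I)
  have "sum x I \<in> rcarrier M" using insert.prems by (intro sum_closed) auto
  then show ?case using insert assms(1) by (simp add: rmod_hom_def)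
qed (simp_all add: hom_zero[OF assms(1,2)])

end

lemma (in group) right_modI: "right_module G M \<Longrightarrow> right_mod G M"
  by unfold_locales

text \<open>First half of Schur's lemma: kernel and image of \<open>f\<close> are submodules, and
  the vector \<open>v\<close> excludes the zero map.\<close>

lemma (in group) irreducible_hom_bij:
  assumes M: "irreducible_module G M" and N: "irreducible_module G N"
    and f: "rmod_hom G M N f" and v: "v \<in> rcarrier M" "f v \<noteq> 0"
  shows "bij_betw f (rcarrier M) (rcarrier N)"
proof -
  interpret M: right_mod G M using M by (intro right_modI) (simp add: irreducible_module_def)
  interpret N: right_mod G N using N by (intro right_modI) (simp add: irreducible_module_def)
  note f' = f[unfolded rmod_hom_def, THEN conjunct1]
    f[unfolded rmod_hom_def, THEN conjunct2, THEN conjunct1, rule_format]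
    f[unfolded rmod_hom_def, THEN conjunct2, THEN conjunct2, THEN conjunct1, rule_format]
    f[unfolded rmod_hom_def, THEN conjunct2, THEN conjunct2, THEN conjunct2, rule_format]
  have f0: "f 0 = 0" using M.hom_zero[OF f N.vector_space_axioms] .
  let ?K = "{v \<in> rcarrier M. f v = 0}"
  have "submodule_on G M ?K"
    by (intro M.submodule_onI M.subspaceI)
       (auto simp: f0 f' M.zero_closed M.add_closed M.scale_closed M.act_closed N.act_zero)
  then have K: "?K = {0}" using M v unfolding irreducible_module_def by blast
  have inj: "inj_on f (rcarrier M)"
  proof (rule inj_onI)
    fix x y assume xy: "x \<in> rcarrier M" "y \<in> rcarrier M" "f x = f y"
    have m: "- y \<in> rcarrier M" "f (- y) = - f y"
      using M.scale_closed[OF xy(2), of "-1"] f'(3)[OF xy(2), of "-1"] by simp_all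
    have "x - y \<in> ?K" using xy m M.add_closed[of x "-y"] f'(2)[of x "-y"] by simp
    then show "x = y" using K by auto
  qed
  have "submodule_on G N (f ` rcarrier M)"
  proof (intro N.submodule_onI N.subspaceI f'(1))
    show "0 \<in> f ` rcarrier M" using f0 M.zero_closed by force
  next
    fix x y assume "x \<in> f ` rcarrier M" "y \<in> f ` rcarrier M"
    then obtain a b where "a \<in> rcarrier M" "b \<in> rcarrier M" "x = f a" "y = f b" by auto
    then show "x + y \<in> f ` rcarrier M" using f'(2)[of a b] M.add_closed[of a b] by (metis imageI)
  next
    fix c x assume "x \<in> f ` rcarrier M"
    then obtain a where "a \<in> rcarrier M" "x = f a" by auto
    then show "rscale N c x \<in> f ` rcarrier M"
      using f'(3)[of a c, symmetric] M.scale_closed[of a c] by simp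
  next
    fix x g assume "x \<in> f ` rcarrier M" "g \<in> carrier G"
    then obtain a where "a \<in> rcarrier M" "x = f a" "g \<in> carrier G" by auto
    then show "ract N x g \<in> f ` rcarrier M"
      using f'(4)[of a g, symmetric] M.act_closed[of a g] by simp
  qed
  moreover have "f ` rcarrier M \<noteq> {0}" using v by auto
  ultimately have "f ` rcarrier M = rcarrier N"
    using N unfolding irreducible_module_def by blast
  with inj show ?thesis by (simp add: bij_betw_def)
qed

text \<open>Any nonzero vector v generates a simple module, so the finitely many vectors v g span
  it. This supplies the finiteness required for finding an eigenvector.\<close>

lemma (in group) irreducible_finite_dim:
  assumes M: "irreducible_module G M" and fin: "finite (carrier G)"
  obtains B where "finite B" "rcarrier M \<subseteq> module.span (rscale M) B"
proof -
  interpret M: right_mod G M using M by (intro right_modI) (simp add: irreducible_module_def)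
  obtain v where v: "v \<in> rcarrier M" "v \<noteq> 0"
    using M M.zero_closed unfolding irreducible_module_def by blast
  let ?B = "ract M v ` carrier G"
  have B: "?B \<subseteq> rcarrier M" using v M.act_closed by auto
  have sub: "M.span ?B \<subseteq> rcarrier M" using B M.subspace_carrier by (rule M.span_minimal)
  have "submodule_on G M (M.span ?B)"
  proof (intro M.submodule_onI sub M.subspace_span)
    fix x g assume x: "x \<in> M.span ?B" and g: "g \<in> carrier G"
    have "x \<in> rcarrier M \<and> ract M x g \<in> M.span ?B" using x
    proof (induction rule: M.span_induct_alt)
      case base
      show ?case using g by (simp add: M.act_zero M.span_zero M.zero_closed)
    next
      case (step c y z)
      then obtain h where h: "h \<in> carrier G" "y = ract M v h" by auto
      have "ract M y g = ract M v (h \<otimes> g)" using h v g by (simp add: M.act_mult)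
      then have "ract M y g \<in> M.span ?B" using h g by (auto intro!: M.span_base)
      moreover have "y \<in> rcarrier M" using h v M.act_closed by simp
      ultimately show ?case
        using step g
        by (simp add: M.act_add M.act_scale M.scale_closed M.add_closed M.span_add M.span_scale)
    qed
    then show "ract M x g \<in> M.span ?B" by simp
  qed
  moreover have "v \<in> M.span ?B"
    using M.act_one[OF v(1)] by (intro M.span_base) (metis imageI one_closed)
  ultimately have "M.span ?B = rcarrier M"
    using M v unfolding irreducible_module_def by blast
  then show ?thesis using that[of ?B] fin by auto
qed

text \<open>Second half of Schur's lemma: an eigenspace of \<open>f\<close> is a submodule, and a
  nonzero one exists over the complex numbers.\<close>

lemma (in group) schur_scalar:
  assumes M: "irreducible_module G M" and fin: "finite (carrier G)" and f: "rmod_hom G M M f"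
  obtains c where "\<And>v. v \<in> rcarrier M \<Longrightarrow> f v = rscale M c v"
proof -
  interpret M: right_mod G M using M by (intro right_modI) (simp add: irreducible_module_def)
  note f' = f[unfolded rmod_hom_def, THEN conjunct1]
    f[unfolded rmod_hom_def, THEN conjunct2, THEN conjunct1, rule_format]
    f[unfolded rmod_hom_def, THEN conjunct2, THEN conjunct2, THEN conjunct1, rule_format]
    f[unfolded rmod_hom_def, THEN conjunct2, THEN conjunct2, THEN conjunct2, rule_format]
  have f0: "f 0 = 0" using M.hom_zero[OF f M.vector_space_axioms] .
  obtain B where B: "finite B" "rcarrier M \<subseteq> M.span B" using irreducible_finite_dim[OF M fin] .
  obtain v where v: "v \<in> rcarrier M" "v \<noteq> 0"
    using M M.zero_closed unfolding irreducible_module_def by blast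
  obtain c x where x: "x \<in> rcarrier M" "x \<noteq> 0" "f x = rscale M c x"
    by (rule exists_eigenvector[OF M.vector_space_axioms M.subspace_carrier B, of f v])
       (use f' v in auto)
  let ?K = "{v \<in> rcarrier M. f v = rscale M c v}"
  have "submodule_on G M ?K"
    by (intro M.submodule_onI M.subspaceI)
       (auto simp: f0 f' M.zero_closed M.add_closed M.scale_closed M.act_closed M.act_scale
          M.scale_right_distrib M.scale_left_commute)
  then have "?K = rcarrier M" using M x unfolding irreducible_module_def by blast
  then show ?thesis using that by blast
qed

section \<open>The unitriangular group and characters of \<open>V\<close>\<close>

lemma mult_mat_index:
  fixes A B :: "'a::semiring_0 mat"
  assumes "A \<in> carrier_mat n m" "B \<in> carrier_mat m l" "i < n" "j < l"
  shows "(A * B) $$ (i, j) = (\<Sum>k<m. A $$ (i, k) * B $$ (k, j))"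
  using assms by (simp add: scalar_prod_def atLeast0LessThan)

lemma finite_carrier_mat: "finite (carrier_mat n m :: 'a::finite mat set)"
proof -
  have "carrier_mat n m \<subseteq> (\<lambda>f. mat n m f) ` (({..<n} \<times> {..<m}) \<rightarrow>\<^sub>E (UNIV :: 'a set))"
  proof
    fix A :: "'a mat" assume A: "A \<in> carrier_mat n m"
    let ?f = "restrict (\<lambda>ij. A $$ ij) ({..<n} \<times> {..<m})"
    have "?f \<in> ({..<n} \<times> {..<m}) \<rightarrow>\<^sub>E UNIV" by auto
    moreover have "A = mat n m ?f" using A by (intro eq_matI) auto
    ultimately show "A \<in> (\<lambda>f. mat n m f) ` (({..<n} \<times> {..<m}) \<rightarrow>\<^sub>E UNIV)"
      by blast
  qed
  then show ?thesis
    by (rule finite_subset) (intro finite_imageI finite_PiE; simp)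
qed

lemma unitriangular_iff:
  "u \<in> carrier (unitriangular_group n) \<longleftrightarrow>
    u \<in> carrier_mat n n \<and> (\<forall>i<n. u $$ (i, i) = 1) \<and> (\<forall>i<n. \<forall>j<n. i < j \<longrightarrow> u $$ (i, j) = 0)"
  by (simp add: unitriangular_group_def)

lemma unitriangular_mult [simp]: "u \<otimes>\<^bsub>unitriangular_group n\<^esub> v = u * v"
  and unitriangular_one [simp]: "\<one>\<^bsub>unitriangular_group n\<^esub> = 1\<^sub>m n"
  by (simp_all add: unitriangular_group_def)

lemma unitriangular_carrier_mat: "u \<in> carrier (unitriangular_group n) \<Longrightarrow> u \<in> carrier_mat n n"
  by (simp add: unitriangular_iff)

lemma strictly_lower_carrier_mat: "A \<in> strictly_lower n \<Longrightarrow> A \<in> carrier_mat n n"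
  by (simp add: strictly_lower_def)

lemma unitriangular_diff_one:
  "u \<in> carrier (unitriangular_group n) \<Longrightarrow> u - 1\<^sub>m n \<in> strictly_lower n"
  "u \<in> carrier (unitriangular_group n) \<Longrightarrow> 1\<^sub>m n - u \<in> strictly_lower n"
  by (auto simp: unitriangular_iff strictly_lower_def dest: le_neq_implies_less)

lemma unitriangular_one_plus:
  "y \<in> strictly_lower n \<Longrightarrow> 1\<^sub>m n + y \<in> carrier (unitriangular_group n)"
  by (auto simp: unitriangular_iff strictly_lower_def)

lemma strictly_lower_closed:
  fixes A B :: "'a::field mat"
  shows "0\<^sub>m n n \<in> strictly_lower n"
    and "A \<in> strictly_lower n \<Longrightarrow> B \<in> strictly_lower n \<Longrightarrow> A + B \<in> strictly_lower n"
    and "A \<in> strictly_lower n \<Longrightarrow> B \<in> strictly_lower n \<Longrightarrow> A - B \<in> strictly_lower n"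
  by (auto simp: strictly_lower_def)

lemma lower_part_closed:
  "A \<in> carrier_mat n n \<Longrightarrow> lower_part A \<in> strictly_lower n"
  by (auto simp: strictly_lower_def lower_part_def)

lemma strictly_lower_mult:
  fixes A u :: "'a::field mat"
  assumes A: "A \<in> strictly_lower n" and u: "u \<in> carrier (unitriangular_group n)"
  shows "A * u \<in> strictly_lower n" "u * A \<in> strictly_lower n"
proof -
  have c: "A \<in> carrier_mat n n" "u \<in> carrier_mat n n"
    using A u by (auto simp: strictly_lower_def unitriangular_iff)
  have z: "A $$ (i, k) * u $$ (k, j) = 0" "u $$ (i, k) * A $$ (k, j) = 0"
    if "i \<le> j" "i < n" "j < n" "k < n" for i j k
    using that A u unfolding strictly_lower_def unitriangular_iff
    by (cases "i \<le> k"; cases "k \<le> j"; simp)+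
  have "(A * u) $$ (i, j) = 0" "(u * A) $$ (i, j) = 0" if "i < n" "j < n" "i \<le> j" for i j
    using that z by (simp_all only: mult_mat_index[OF c] mult_mat_index[OF c(2,1)])
      (auto intro!: sum.neutral)
  then show "A * u \<in> strictly_lower n" "u * A \<in> strictly_lower n"
    using c by (auto simp: strictly_lower_def)
qed

lemma unitriangular_closed:
  fixes u v :: "'a::field mat"
  assumes u: "u \<in> carrier (unitriangular_group n)" and v: "v \<in> carrier (unitriangular_group n)"
  shows "u * v \<in> carrier (unitriangular_group n)"
proof -
  have c: "u \<in> carrier_mat n n" "v \<in> carrier_mat n n"
    using u v by (simp_all add: unitriangular_carrier_mat)
  have "u * v = 1\<^sub>m n + ((u - 1\<^sub>m n) * v + (v - 1\<^sub>m n))"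
    using c by (simp add: minus_mult_distrib_mat) (rule eq_matI; auto)
  moreover have "(u - 1\<^sub>m n) * v + (v - 1\<^sub>m n) \<in> strictly_lower n"
    using u v by (intro strictly_lower_closed strictly_lower_mult unitriangular_diff_one)
  ultimately show ?thesis by (simp add: unitriangular_one_plus)
qed

lemma finite_unitriangular:
  "finite (carrier (unitriangular_group n :: 'a::{field, finite} mat monoid))"
  by (rule finite_subset[OF _ finite_carrier_mat]) (auto simp: unitriangular_iff)

lemma finite_strictly_lower: "finite (strictly_lower n :: 'a::{field, finite} mat set)"
  by (rule finite_subset[OF _ finite_carrier_mat]) (auto simp: strictly_lower_def)

text \<open>The point is the existence of inverses inside U. Since det u = 1, the adjugate is a
  right inverse of u among all matrices, so v |-> v u is an injective self-map of U; as U is finite,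
  this map is onto and hits 1.\<close>

lemma group_unitriangular:
  "group (unitriangular_group n :: 'a::{field, finite} mat monoid)" (is "group ?G")
proof (rule groupI)
  show "\<one>\<^bsub>?G\<^esub> \<in> carrier ?G" by (simp add: unitriangular_iff)
next
  fix u :: "'a mat" assume u: "u \<in> carrier ?G"
  have uc: "u \<in> carrier_mat n n" using u by (rule unitriangular_carrier_mat)
  have "det u = prod_list (diag_mat u)"
    by (rule det_lower_triangular[OF _ uc]) (use u in \<open>auto simp: unitriangular_iff\<close>)
  also have "diag_mat u = replicate n 1"
    using u by (intro nth_equalityI) (auto simp: diag_mat_def unitriangular_iff)
  finally have "det u = 1" by simp
  moreover have "1 \<cdot>\<^sub>m 1\<^sub>m n = (1\<^sub>m n :: 'a mat)" by (rule eq_matI) auto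
  ultimately have w: "adj_mat u \<in> carrier_mat n n" "u * adj_mat u = 1\<^sub>m n"
    using adj_mat[OF uc] by simp_all
  have "inj_on (\<lambda>v. v * u) (carrier ?G)"
  proof (rule inj_onI)
    fix v v' :: "'a mat" assume v: "v \<in> carrier ?G" "v' \<in> carrier ?G" "v * u = v' * u"
    have "z * u * adj_mat u = z" if "z \<in> carrier ?G" for z
      using assoc_mult_mat[OF unitriangular_carrier_mat[OF that] uc w(1)] w(2)
      by (simp add: right_mult_one_mat[OF unitriangular_carrier_mat[OF that]])
    then show "v = v'" using v by metis
  qed
  moreover have "(\<lambda>v. v * u) ` carrier ?G \<subseteq> carrier ?G"
    using u unitriangular_closed by auto
  ultimately have "(\<lambda>v. v * u) ` carrier ?G = carrier ?G"
    by (intro endo_inj_surj finite_unitriangular)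
  moreover have "1\<^sub>m n \<in> carrier ?G" by (simp add: unitriangular_iff)
  ultimately show "\<exists>v\<in>carrier ?G. v \<otimes>\<^bsub>?G\<^esub> u = \<one>\<^bsub>?G\<^esub>" by (metis imageE unitriangular_mult unitriangular_one)
qed (simp_all add: unitriangular_closed assoc_mult_mat[where n\<^sub>1=n and n\<^sub>2=n and n\<^sub>3=n and n\<^sub>4=n]
    unitriangular_carrier_mat left_mult_one_mat[OF unitriangular_carrier_mat])

locale unitriangular_character =
  fixes n :: nat and \<theta> :: "'a::{field, finite} \<Rightarrow> complex"
  assumes \<theta>: "nontrivial_character \<theta>"
begin

abbreviation "G \<equiv> (unitriangular_group n :: 'a mat monoid)"
abbreviation "U \<equiv> carrier G"
abbreviation "V \<equiv> (strictly_lower n :: 'a mat set)"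

sublocale group G by (rule group_unitriangular)

section \<open>The duality on V and its additive characters\<close>

definition pairing :: "'a mat \<Rightarrow> 'a mat \<Rightarrow> 'a" where
  "pairing A B = (\<Sum>i<n. \<Sum>j<n. A $$ (i, j) * B $$ (i, j))"

text \<open>This is the left action of the inverse of \<open>x\<close>, so that \<open>lact x (lact y A) = lact (y * x) A\<close>.\<close>

definition lact :: "'a mat \<Rightarrow> 'a mat \<Rightarrow> 'a mat" where
  "lact x A = lower_part (transpose_mat x * A)"

lemma theta_simps: "\<theta> (x + y) = \<theta> x * \<theta> y" "\<theta> x \<noteq> 0" "\<theta> 0 = 1"
    "\<theta> (- x) = inverse (\<theta> x)" "\<theta> (x - y) = \<theta> x / \<theta> y"
proof -
  show a: "\<theta> (x + y) = \<theta> x * \<theta> y" and b: "\<theta> x \<noteq> 0" for x y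
    using \<theta> by (simp_all add: nontrivial_character_def)
  show c: "\<theta> 0 = 1" using a[of 0 0] b[of 0] by simp
  show d: "\<theta> (- x) = inverse (\<theta> x)" for x
    using a[of "-x" x] b c by (simp add: field_simps)
  show "\<theta> (x - y) = \<theta> x / \<theta> y" using a[of x "-y"] d[of y] by (simp add: divide_inverse)
qed

lemma chi_pairing: "A \<in> carrier_mat n n \<Longrightarrow> chi \<theta> A B = \<theta> (pairing A B)"
  by (auto simp: chi_def pairing_def)

lemma pairing_commute: "pairing A B = pairing B A"
  by (simp add: pairing_def mult.commute)

lemma pairing_add: "A \<in> carrier_mat n n \<Longrightarrow> B \<in> carrier_mat n n \<Longrightarrow> C \<in> carrier_mat n n \<Longrightarrow>
    pairing A (B + C) = pairing A B + pairing A C"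
  and pairing_diff: "A \<in> carrier_mat n n \<Longrightarrow> B \<in> carrier_mat n n \<Longrightarrow> C \<in> carrier_mat n n \<Longrightarrow>
    pairing A (B - C) = pairing A B - pairing A C"
  by (simp_all add: pairing_def distrib_left right_diff_distrib sum.distrib sum_subtractf)

lemma pairing_diff_left:
  "A \<in> carrier_mat n n \<Longrightarrow> B \<in> carrier_mat n n \<Longrightarrow> C \<in> carrier_mat n n \<Longrightarrow>
    pairing (A - B) C = pairing A C - pairing B C"
  by (subst (1 2 3) pairing_commute) (rule pairing_diff)

text \<open>Truncation is invisible when pairing with a strictly lower matrix, so right
  multiplication by w^t is adjoint to right multiplication by w. This turns the truncated actions
  into plain matrix products in the second argument.\<close>

lemma pairing_lower_right:
  assumes "A \<in> carrier_mat n n" "w \<in> carrier_mat n n" "B \<in> V"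
  shows "pairing (lower_part (A * transpose_mat w)) B = pairing A (B * w)"
proof -
  have B: "B \<in> carrier_mat n n" using assms by (simp add: strictly_lower_def)
  have "pairing (lower_part (A * transpose_mat w)) B =
    (\<Sum>i<n. \<Sum>j<n. \<Sum>k<n. A $$ (i, k) * w $$ (j, k) * B $$ (i, j))"
    unfolding pairing_def
  proof (intro sum.cong refl)
    fix i j assume ij: "i \<in> {..<n}" "j \<in> {..<n}"
    have "lower_part (A * transpose_mat w) $$ (i, j) * B $$ (i, j)
      = (A * transpose_mat w) $$ (i, j) * B $$ (i, j)"
      using ij assms by (auto simp: lower_part_def strictly_lower_def)
    also have "(A * transpose_mat w) $$ (i, j) = (\<Sum>k<n. A $$ (i, k) * w $$ (j, k))"
      using ij assms by (subst mult_mat_index[where n=n and m=n and l=n]) auto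
    finally show "lower_part (A * transpose_mat w) $$ (i, j) * B $$ (i, j)
      = (\<Sum>k<n. A $$ (i, k) * w $$ (j, k) * B $$ (i, j))" by (simp add: sum_distrib_right)
  qed
  also have "\<dots> = (\<Sum>i<n. \<Sum>k<n. \<Sum>j<n. A $$ (i, k) * w $$ (j, k) * B $$ (i, j))"
    by (intro sum.cong refl sum.swap)
  also have "\<dots> = pairing A (B * w)"
    unfolding pairing_def
    by (intro sum.cong refl, subst mult_mat_index[OF B assms(2)])
       (auto simp: sum_distrib_left mult_ac)
  finally show ?thesis .
qed

lemma pairing_lower_left:
  assumes "A \<in> carrier_mat n n" "w \<in> carrier_mat n n" "B \<in> V"
  shows "pairing (lower_part (transpose_mat w * A)) B = pairing A (w * B)"
proof -
  have B: "B \<in> carrier_mat n n" using assms by (simp add: strictly_lower_def)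
  have "pairing (lower_part (transpose_mat w * A)) B =
    (\<Sum>i<n. \<Sum>j<n. \<Sum>k<n. w $$ (k, i) * A $$ (k, j) * B $$ (i, j))"
    unfolding pairing_def
  proof (intro sum.cong refl)
    fix i j assume ij: "i \<in> {..<n}" "j \<in> {..<n}"
    have "lower_part (transpose_mat w * A) $$ (i, j) * B $$ (i, j)
      = (transpose_mat w * A) $$ (i, j) * B $$ (i, j)"
      using ij assms by (auto simp: lower_part_def strictly_lower_def)
    also have "(transpose_mat w * A) $$ (i, j) = (\<Sum>k<n. w $$ (k, i) * A $$ (k, j))"
      using ij assms by (subst mult_mat_index[where n=n and m=n and l=n]) auto
    finally show "lower_part (transpose_mat w * A) $$ (i, j) * B $$ (i, j)
      = (\<Sum>k<n. w $$ (k, i) * A $$ (k, j) * B $$ (i, j))" by (simp add: sum_distrib_right)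
  qed
  also have "\<dots> = (\<Sum>j<n. \<Sum>i<n. \<Sum>k<n. w $$ (k, i) * A $$ (k, j) * B $$ (i, j))"
    by (rule sum.swap)
  also have "\<dots> = (\<Sum>j<n. \<Sum>k<n. \<Sum>i<n. w $$ (k, i) * A $$ (k, j) * B $$ (i, j))"
    by (intro sum.cong refl sum.swap)
  also have "\<dots> = (\<Sum>k<n. \<Sum>j<n. \<Sum>i<n. w $$ (k, i) * A $$ (k, j) * B $$ (i, j))"
    by (rule sum.swap)
  also have "\<dots> = pairing A (w * B)"
    unfolding pairing_def
    by (intro sum.cong refl, subst mult_mat_index[OF assms(2) B])
       (auto simp: sum_distrib_left mult_ac)
  finally show ?thesis .
qed

lemma pairing_unit:
  assumes "j < i" "i < n"
  shows "mat n n (\<lambda>kl. if kl = (i, j) then c else 0) \<in> V" (is "?E \<in> V")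
    and "A \<in> carrier_mat n n \<Longrightarrow>
      pairing A (mat n n (\<lambda>kl. if kl = (i, j) then c else 0)) = A $$ (i, j) * c"
proof -
  show "?E \<in> V" using assms by (auto simp: strictly_lower_def)
  have "pairing A ?E = (\<Sum>k<n. \<Sum>l<n. if l = j then if k = i then A $$ (i, j) * c else 0 else 0)"
    unfolding pairing_def by (intro sum.cong refl) auto
  also have "\<dots> = A $$ (i, j) * c" using assms by simp
  finally show "pairing A ?E = A $$ (i, j) * c" .
qed

text \<open>Nondegeneracy of the pairing on V, tested on matrix units. The laws of the two actions
  are proved through it: paired with B, identities between truncated products become identities
  between ordinary products.\<close>

lemma pairing_eqI:
  assumes "C \<in> V" "D \<in> V" "\<And>B. B \<in> V \<Longrightarrow> pairing C B = pairing D B"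
  shows "C = D"
proof (rule eq_matI)
  fix i j assume ij: "i < dim_row D" "j < dim_col D"
  then have ij': "i < n" "j < n" using assms(2) by (auto simp: strictly_lower_def)
  show "C $$ (i, j) = D $$ (i, j)"
  proof (cases "j < i")
    case True
    show ?thesis
      using assms(3)[OF pairing_unit(1)[OF True ij'(1), of 1]] assms(1,2)
      by (simp add: pairing_unit(2)[OF True ij'(1)] strictly_lower_carrier_mat)
  next
    case False
    then show ?thesis using assms(1,2) ij' by (simp add: strictly_lower_def)
  qed
qed (use assms in \<open>auto simp: strictly_lower_def\<close>)

text \<open>Orthogonality of characters: for nonzero C, shifting the variable by some y at which the
  character is not 1 multiplies the sum by that value.\<close>

lemma sum_theta_pairing:
  assumes C: "C \<in> V"
  shows "(\<Sum>y\<in>V. \<theta> (pairing C y)) = (if C = 0\<^sub>m n n then of_nat (card V) else 0)"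
proof (cases "C = 0\<^sub>m n n")
  case True
  then have "pairing C y = 0" for y by (simp add: pairing_def)
  then show ?thesis using True by (simp add: theta_simps)
next
  case False
  have Cc: "C \<in> carrier_mat n n" using C by (rule strictly_lower_carrier_mat)
  obtain i j where ij: "i < n" "j < n" "C $$ (i, j) \<noteq> 0"
    using False Cc eq_matI[of "0\<^sub>m n n" C] by auto
  then have ji: "j < i" using C unfolding strictly_lower_def by (metis (mono_tags, lifting) mem_Collect_eq not_le)
  obtain x where x: "\<theta> x \<noteq> 1" using \<theta> by (auto simp: nontrivial_character_def)
  \<comment> \<open>Dividing by a nonzero entry of C makes the pairing of C with y equal to x, where
    \<theta> is not 1.\<close>
  define y where "y = mat n n (\<lambda>kl. if kl = (i, j) then x / C $$ (i, j) else 0)"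
  have y: "y \<in> V" "pairing C y = x"
    using pairing_unit[OF ji ij(1)] ij(3) Cc by (simp_all add: y_def)
  have yc: "y \<in> carrier_mat n n" using y by (simp add: strictly_lower_carrier_mat)
  have "(\<Sum>z\<in>V. \<theta> (pairing C z)) = (\<Sum>z\<in>V. \<theta> (pairing C (z + y)))"
  proof (rule sum.reindex_bij_witness[where i="\<lambda>z. z + y" and j="\<lambda>z. z - y"])
    fix z assume z: "z \<in> V"
    then have zc: "z \<in> carrier_mat n n" by (rule strictly_lower_carrier_mat)
    show "z - y + y = z" "z + y - y = z" using zc yc by (auto intro!: eq_matI)
    then show "\<theta> (pairing C (z - y + y)) = \<theta> (pairing C z)" by simp
    show "z - y \<in> V" "z + y \<in> V" using z y by (auto intro: strictly_lower_closed)
  qed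
  also have "\<dots> = (\<Sum>z\<in>V. \<theta> (pairing C z)) * \<theta> x"
    using y by (simp add: pairing_add[OF Cc] yc strictly_lower_carrier_mat theta_simps sum_distrib_right)
  finally show ?thesis using x False by simp
qed

section \<open>The cocycle and the two commuting actions on V\<close>

abbreviation "iv \<equiv> m_inv G"

text \<open>This is the scalar chi_A(1 - u^-1) in [A] u. As a function of u it is a 1-cocycle for
  the right action, and on the stabilizer of A it is the linear character psi_A.\<close>

definition cocycle :: "'a mat \<Rightarrow> 'a mat \<Rightarrow> complex" where
  "cocycle A u = \<theta> (pairing A (1\<^sub>m n - iv u))"

lemma inv_U: "u \<in> U \<Longrightarrow> iv u \<in> U" "u \<in> U \<Longrightarrow> u * iv u = 1\<^sub>m n" "u \<in> U \<Longrightarrow> iv u * u = 1\<^sub>m n"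
    "u \<in> U \<Longrightarrow> iv (iv u) = u"
    "u \<in> U \<Longrightarrow> v \<in> U \<Longrightarrow> iv (u * v) = iv v * iv u" "iv (1\<^sub>m n) = 1\<^sub>m n"
  using r_inv l_inv inv_inv inv_mult_group inv_one by simp_all

lemma one_U: "1\<^sub>m n \<in> U"
  using one_closed by simp

lemmas UV_carrier_mat = unitriangular_carrier_mat strictly_lower_carrier_mat

lemma assoc_U: "u \<in> U \<Longrightarrow> v \<in> U \<Longrightarrow> w \<in> U \<Longrightarrow> u * v * w = u * (v * w)"
  by (intro assoc_mult_mat[of _ n n _ n _ n] unitriangular_carrier_mat)

lemma mult_inv_cancel: "u \<in> U \<Longrightarrow> v \<in> U \<Longrightarrow> u * (iv u * v) = v" "u \<in> U \<Longrightarrow> v \<in> U \<Longrightarrow> iv u * (u * v) = v"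
    "u \<in> U \<Longrightarrow> v \<in> U \<Longrightarrow> v * iv u * u = v" "u \<in> U \<Longrightarrow> v \<in> U \<Longrightarrow> v * u * iv u = v"
proof -
  assume *: "u \<in> U" "v \<in> U"
  then have c: "v \<in> carrier_mat n n" by (rule_tac unitriangular_carrier_mat)
  show "u * (iv u * v) = v" "iv u * (u * v) = v"
    using * c by (simp_all add: assoc_U[symmetric] inv_U)
  show "v * iv u * u = v" "v * u * iv u = v"
    using * c by (simp_all add: assoc_U inv_U)
qed

lemma sum_U_inv: "(\<Sum>u\<in>U. f (iv u)) = (\<Sum>u\<in>U. f u)"
  by (rule sum.reindex_bij_witness[where i="\<lambda>u. iv u" and j="\<lambda>u. iv u"]) (simp_all add: inv_U)

lemma sum_U_mult_left: "u \<in> U \<Longrightarrow> (\<Sum>w\<in>U. f (u * w)) = (\<Sum>w\<in>U. f w)"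
  by (rule sum.reindex_bij_witness[where i="\<lambda>w. iv u * w" and j="\<lambda>w. u * w"])
     (simp_all add: inv_U mult_inv_cancel unitriangular_closed)

lemma sum_U_mult_right: "u \<in> U \<Longrightarrow> (\<Sum>w\<in>U. f (w * u)) = (\<Sum>w\<in>U. f w)"
  by (rule sum.reindex_bij_witness[where i="\<lambda>w. w * iv u" and j="\<lambda>w. w * u"])
     (simp_all add: inv_U mult_inv_cancel unitriangular_closed)

lemma one_plus_diff: "u \<in> carrier_mat n n \<Longrightarrow> 1\<^sub>m n + (u - 1\<^sub>m n) = (u :: 'a mat)"
    "u \<in> carrier_mat n n \<Longrightarrow> 1\<^sub>m n + u - 1\<^sub>m n = (u :: 'a mat)"
  by (rule eq_matI; auto)+

lemma sum_U_V: "(\<Sum>u\<in>U. f u) = (\<Sum>y\<in>V. f (1\<^sub>m n + y))"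
  by (rule sum.reindex_bij_witness[where i="\<lambda>y. 1\<^sub>m n + y" and j="\<lambda>u. u - 1\<^sub>m n"])
     (simp_all add: one_plus_diff UV_carrier_mat unitriangular_one_plus unitriangular_diff_one)

lemma dot_act_closed: "A \<in> V \<Longrightarrow> u \<in> U \<Longrightarrow> dot_act n A u \<in> V"
  unfolding dot_act_def
  by (intro lower_part_closed mult_carrier_mat[where n=n]) (simp_all add: UV_carrier_mat inv_U)

lemma lact_closed: "A \<in> V \<Longrightarrow> x \<in> U \<Longrightarrow> lact x A \<in> V"
  unfolding lact_def
  by (intro lower_part_closed mult_carrier_mat[where n=n]) (simp_all add: UV_carrier_mat)

lemma pairing_dot_act:
  "A \<in> V \<Longrightarrow> u \<in> U \<Longrightarrow> B \<in> V \<Longrightarrow> pairing (dot_act n A u) B = pairing A (B * iv u)"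
  unfolding dot_act_def by (intro pairing_lower_right) (simp_all add: UV_carrier_mat inv_U)

lemma pairing_lact:
  "A \<in> V \<Longrightarrow> x \<in> U \<Longrightarrow> B \<in> V \<Longrightarrow> pairing (lact x A) B = pairing A (x * B)"
  unfolding lact_def by (intro pairing_lower_left) (simp_all add: UV_carrier_mat)

lemma dot_act_one: "A \<in> V \<Longrightarrow> dot_act n A (1\<^sub>m n) = A"
  by (rule pairing_eqI)
     (simp_all add: pairing_dot_act one_U dot_act_closed inv_U
        right_mult_one_mat[OF strictly_lower_carrier_mat])

lemma dot_act_mult:
  assumes "A \<in> V" "u \<in> U" "v \<in> U"
  shows "dot_act n (dot_act n A u) v = dot_act n A (u * v)"
proof (rule pairing_eqI)
  fix B assume B: "B \<in> V"
  have "B * iv v * iv u = B * (iv v * iv u)"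
    using assms B by (intro assoc_mult_mat[of _ n n _ n _ n]) (auto simp: UV_carrier_mat inv_U)
  then show "pairing (dot_act n (dot_act n A u) v) B = pairing (dot_act n A (u * v)) B"
    using assms B by (simp add: pairing_dot_act dot_act_closed unitriangular_closed inv_U strictly_lower_mult)
qed (use assms in \<open>simp_all add: dot_act_closed unitriangular_closed\<close>)

lemma dot_act_inv:
  assumes "A \<in> V" "u \<in> U"
  shows "dot_act n (dot_act n A u) (iv u) = A" "dot_act n (dot_act n A (iv u)) u = A"
  using assms by (simp_all add: dot_act_mult inv_U dot_act_one)

lemma dot_act_eq_iff:
  assumes "A \<in> V" "B \<in> V" "u \<in> U"
  shows "dot_act n A u = B \<longleftrightarrow> A = dot_act n B (iv u)"
  using assms dot_act_inv by metis

lemma lact_one: "A \<in> V \<Longrightarrow> lact (1\<^sub>m n) A = A"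
  by (rule pairing_eqI)
     (simp_all add: pairing_lact one_U lact_closed left_mult_one_mat[OF strictly_lower_carrier_mat])

lemma lact_mult:
  assumes "A \<in> V" "x \<in> U" "y \<in> U"
  shows "lact x (lact y A) = lact (y * x) A"
proof (rule pairing_eqI)
  fix B assume B: "B \<in> V"
  have "y * (x * B) = y * x * B"
    using assms B by (intro assoc_mult_mat[of _ n n _ n _ n, symmetric]) (auto simp: UV_carrier_mat)
  then show "pairing (lact x (lact y A)) B = pairing (lact (y * x) A) B"
    using assms B by (simp add: pairing_lact lact_closed unitriangular_closed strictly_lower_mult)
qed (use assms in \<open>simp_all add: lact_closed unitriangular_closed\<close>)

lemma lact_dot_act:
  assumes "A \<in> V" "x \<in> U" "u \<in> U"
  shows "lact x (dot_act n A u) = dot_act n (lact x A) u"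
proof (rule pairing_eqI)
  fix B assume B: "B \<in> V"
  have "x * B * iv u = x * (B * iv u)"
    using assms B by (intro assoc_mult_mat[of _ n n _ n _ n]) (auto simp: UV_carrier_mat inv_U)
  then show "pairing (lact x (dot_act n A u)) B = pairing (dot_act n (lact x A) u) B"
    using assms B by (simp add: pairing_lact pairing_dot_act lact_closed dot_act_closed
        unitriangular_closed strictly_lower_mult inv_U)
qed (use assms in \<open>simp_all add: lact_closed dot_act_closed\<close>)

lemma cocycle_one: "cocycle A (1\<^sub>m n) = 1"
  by (simp add: cocycle_def inv_U pairing_def theta_simps)

text \<open>Write 1 - (uv)^-1 as (1 - u^-1) + (1 - v^-1) u^-1 and move the factor u^-1 to the other
  side of the pairing. The identity expresses that [A](uv) = ([A]u)v.\<close>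

lemma cocycle_mult:
  assumes "A \<in> V" "u \<in> U" "v \<in> U"
  shows "cocycle A (u * v) = cocycle A u * cocycle (dot_act n A u) v"
proof -
  have c: "A \<in> carrier_mat n n" "iv u \<in> carrier_mat n n" "iv v \<in> carrier_mat n n"
    using assms by (simp_all add: UV_carrier_mat inv_U)
  have "1\<^sub>m n - iv v * iv u = (1\<^sub>m n - iv u) + (1\<^sub>m n - iv v) * iv u"
    unfolding minus_mult_distrib_mat[OF one_carrier_mat c(3,2)] using c by (intro eq_matI) auto
  moreover have "pairing (dot_act n A u) (1\<^sub>m n - iv v) = pairing A ((1\<^sub>m n - iv v) * iv u)"
    using assms by (intro pairing_dot_act unitriangular_diff_one inv_U)
  moreover have "1\<^sub>m n - iv u \<in> carrier_mat n n" "(1\<^sub>m n - iv v) * iv u \<in> carrier_mat n n"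
    using c by (auto intro!: mult_carrier_mat)
  ultimately show ?thesis
    using assms by (simp add: cocycle_def inv_U pairing_add[OF c(1)] theta_simps)
qed

lemma cocycle_nonzero: "cocycle A u \<noteq> 0"
  by (simp add: cocycle_def theta_simps)

lemma cocycle_inv:
  assumes "A \<in> V" "u \<in> U"
  shows "cocycle (dot_act n A u) (iv u) = inverse (cocycle A u)"
  using cocycle_mult[OF assms inv_U(1)[OF assms(2)]] assms cocycle_nonzero[of A u]
  by (simp add: inv_U cocycle_one field_simps)

text \<open>Orthogonality in the other variable: for fixed u the cocycle is an additive character of
  B, trivial only for u = 1. It is the source of the fact that the operators attached to all [B] add
  up to a multiple of the identity.\<close>

lemma sum_cocycle_V:
  assumes u: "u \<in> U"
  shows "(\<Sum>B\<in>V. cocycle B u) = (if u = 1\<^sub>m n then of_nat (card V) else 0)"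
proof -
  have "(\<Sum>B\<in>V. cocycle B u) = (\<Sum>B\<in>V. \<theta> (pairing (1\<^sub>m n - iv u) B))"
    unfolding cocycle_def by (simp add: pairing_commute)
  also have "\<dots> = (if 1\<^sub>m n - iv u = 0\<^sub>m n n then of_nat (card V) else 0)"
    using u by (intro sum_theta_pairing unitriangular_diff_one inv_U)
  also have "1\<^sub>m n - iv u = 0\<^sub>m n n \<longleftrightarrow> u = 1\<^sub>m n"
  proof
    assume "1\<^sub>m n - iv u = 0\<^sub>m n n"
    moreover have "1\<^sub>m n - (1\<^sub>m n - iv u) = iv u"
      using u by (intro eq_matI) (auto simp: inv_U unitriangular_carrier_mat[OF inv_U(1)])
    moreover have "1\<^sub>m n - 0\<^sub>m n n = (1\<^sub>m n :: 'a mat)" by (rule eq_matI) auto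
    ultimately have "iv u = 1\<^sub>m n" by simp
    then show "u = 1\<^sub>m n" using u inv_U by metis
  qed (use inv_U in auto)
  finally show ?thesis .
qed

text \<open>The substitution \<open>u = 1 + y\<close> turns the sum into a sum of an additive character of \<open>V\<close>.\<close>

lemma sum_cocycle_convolution:
  assumes B: "B \<in> V" and C: "C \<in> V" and w: "w \<in> U"
  shows "(\<Sum>u\<in>U. cocycle C (iv (u * w)) * inverse (cocycle B (iv u))) =
    (if dot_act n B w = C then of_nat (card V) * cocycle C (iv w) else 0)"
proof -
  \<comment> \<open>For u = 1 + y one has 1 - u w = (1 - w) - y w, so the total exponent is the
    pairing of C with 1 - w plus the pairing of \<open>?D\<close> with y. The sum over y survives
    only if \<open>?D\<close> is zero, that is, if w carries B to C.\<close>
  let ?D = "B - dot_act n C (iv w)"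
  have D: "?D \<in> V" using assms by (intro strictly_lower_closed dot_act_closed inv_U)
  have c: "B \<in> carrier_mat n n" "C \<in> carrier_mat n n" "w \<in> carrier_mat n n"
      "dot_act n C (iv w) \<in> carrier_mat n n"
    using assms by (simp_all add: UV_carrier_mat inv_U dot_act_closed)
  have "(\<Sum>u\<in>U. cocycle C (iv (u * w)) * inverse (cocycle B (iv u))) =
    (\<Sum>y\<in>V. cocycle C (iv ((1\<^sub>m n + y) * w)) * inverse (cocycle B (iv (1\<^sub>m n + y))))"
    by (rule sum_U_V)
  also have "\<dots> = (\<Sum>y\<in>V. cocycle C (iv w) * \<theta> (pairing ?D y))"
  proof (intro sum.cong refl)
    fix y assume y: "y \<in> V"
    have yc: "y \<in> carrier_mat n n" using y by (simp add: UV_carrier_mat)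
    have ywV: "y * w \<in> V" using y w by (rule strictly_lower_mult)
    have 1: "1\<^sub>m n - (1\<^sub>m n + y) * w = (1\<^sub>m n - w) - y * w"
      unfolding add_mult_distrib_mat[OF one_carrier_mat yc c(3)] using c yc by (intro eq_matI) auto
    have 2: "1\<^sub>m n - (1\<^sub>m n + y) = 0\<^sub>m n n - y"
      using yc by (intro eq_matI) auto
    have 3: "pairing (dot_act n C (iv w)) y = pairing C (y * w)"
      using assms y by (simp add: pairing_dot_act inv_U)
    have 4: "pairing B (0\<^sub>m n n) = 0" by (simp add: pairing_def)
    have 5: "1\<^sub>m n + y \<in> U" using y by (rule unitriangular_one_plus)
    have 6: "1\<^sub>m n - w \<in> carrier_mat n n" "y * w \<in> carrier_mat n n" "0\<^sub>m n n \<in> carrier_mat n n"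
      using c yc by auto
    have "pairing C (1\<^sub>m n - (1\<^sub>m n + y) * w) = pairing C (1\<^sub>m n - w) - pairing (dot_act n C (iv w)) y"
      unfolding 1 3 by (rule pairing_diff[OF c(2) 6(1,2)])
    moreover have "pairing B (1\<^sub>m n - (1\<^sub>m n + y)) = - pairing B y"
      unfolding 2 by (simp add: pairing_diff[OF c(1) 6(3) yc] 4)
    moreover have "pairing ?D y = pairing B y - pairing (dot_act n C (iv w)) y"
      by (rule pairing_diff_left[OF c(1,4) yc])
    ultimately show "cocycle C (iv ((1\<^sub>m n + y) * w)) * inverse (cocycle B (iv (1\<^sub>m n + y))) =
      cocycle C (iv w) * \<theta> (pairing ?D y)"
      using w 5 by (simp add: cocycle_def inv_U unitriangular_closed theta_simps)
  qed
  also have "\<dots> = cocycle C (iv w) * (if ?D = 0\<^sub>m n n then of_nat (card V) else 0)"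
    by (simp add: sum_distrib_left[symmetric] sum_theta_pairing[OF D])
  also have "?D = 0\<^sub>m n n \<longleftrightarrow> dot_act n B w = C"
  proof -
    have "?D = 0\<^sub>m n n \<longleftrightarrow> B = dot_act n C (iv w)"
    proof
      assume D0: "?D = 0\<^sub>m n n"
      have "?D + dot_act n C (iv w) = B" using c by (intro eq_matI) auto
      then show "B = dot_act n C (iv w)" using D0 c by simp
    qed (use c in auto)
    then show ?thesis using assms by (simp add: dot_act_eq_iff)
  qed
  finally show ?thesis by simp
qed

definition stabilizer :: "'a mat \<Rightarrow> 'a mat set" where
  "stabilizer A = {u \<in> U. dot_act n A u = A}"

lemma stabilizer_one: "A \<in> V \<Longrightarrow> 1\<^sub>m n \<in> stabilizer A"
  by (simp add: stabilizer_def one_U dot_act_one)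

lemma finite_stabilizer: "finite (stabilizer A)"
  by (simp add: stabilizer_def finite_unitriangular)

lemma card_V: "card V \<noteq> 0"
proof -
  have "0\<^sub>m n n \<in> V" by (rule strictly_lower_closed)
  then show ?thesis using finite_strictly_lower by (auto simp: card_eq_0_iff)
qed

lemma card_stabilizer_pos: "A \<in> V \<Longrightarrow> card (stabilizer A) > 0"
  using stabilizer_one finite_stabilizer by (metis card_gt_0_iff empty_iff)

end

section \<open>Weight spaces\<close>

locale unitriangular_module = unitriangular_character n \<theta> +
    right_mod "unitriangular_group n :: 'a mat monoid" M
  for n :: nat and \<theta> :: "'a::{field, finite} \<Rightarrow> complex"
    and M :: "('a mat, 'v::ab_group_add) rmod"
begin

abbreviation "sc \<equiv> rscale M"
abbreviation "act \<equiv> ract M"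

text \<open>Up to positive scalars, \<open>F B\<close> and \<open>F_adj B\<close> are the actions of the image of the basis
  element \<open>[B]\<close> in the group algebra and of its adjoint.\<close>

definition F :: "'a mat \<Rightarrow> 'v \<Rightarrow> 'v" where
  "F B s = (\<Sum>u\<in>U. sc (cocycle B (iv u)) (act s u))"

definition F_adj :: "'a mat \<Rightarrow> 'v \<Rightarrow> 'v" where
  "F_adj B t = (\<Sum>u\<in>U. sc (inverse (cocycle B (iv u))) (act t (iv u)))"

definition weight_space :: "'a mat \<Rightarrow> 'v set" where
  "weight_space A = {s \<in> rcarrier M. \<forall>u\<in>stabilizer A. act s u = sc (cocycle A u) s}"

lemma F_closed: "s \<in> rcarrier M \<Longrightarrow> F B s \<in> rcarrier M"
  unfolding F_def by (intro sum_closed scale_closed act_closed)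

lemma F_adj_closed: "s \<in> rcarrier M \<Longrightarrow> F_adj B s \<in> rcarrier M"
  unfolding F_adj_def by (intro sum_closed scale_closed act_closed inv_U)

lemma F_add: "s \<in> rcarrier M \<Longrightarrow> t \<in> rcarrier M \<Longrightarrow> F B (s + t) = F B s + F B t"
  by (simp add: F_def act_add scale_right_distrib sum.distrib)

lemma F_scale: "s \<in> rcarrier M \<Longrightarrow> F B (sc c s) = sc c (F B s)"
  by (simp add: F_def act_scale scale_sum_right mult.commute)

lemma F_zero: "F B 0 = 0"
  by (simp add: F_def act_zero)

lemma F_sum:
  assumes "\<And>i. i \<in> I \<Longrightarrow> x i \<in> rcarrier M"
  shows "F B (\<Sum>i\<in>I. x i) = (\<Sum>i\<in>I. F B (x i))"
  using assms
proof (induction I rule: infinite_finite_induct)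
  case (insert a I)
  have "sum x I \<in> rcarrier M" using insert.prems by (intro sum_closed) auto
  then show ?case using insert by (simp add: F_add)
qed (simp_all add: F_zero)

lemma F_adj_sum_scale:
  assumes "\<And>i. i \<in> I \<Longrightarrow> x i \<in> rcarrier M"
  shows "F_adj B (\<Sum>i\<in>I. sc (c i) (x i)) = (\<Sum>i\<in>I. sc (c i) (F_adj B (x i)))"
proof -
  have "F_adj B (\<Sum>i\<in>I. sc (c i) (x i)) =
    (\<Sum>u\<in>U. \<Sum>i\<in>I. sc (inverse (cocycle B (iv u))) (sc (c i) (act (x i) (iv u))))"
    unfolding F_adj_def using assms
    by (intro sum.cong refl) (simp add: act_sum scale_closed act_scale inv_U scale_sum_right)
  also have "\<dots> = (\<Sum>i\<in>I. sc (c i) (F_adj B (x i)))"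
    unfolding F_adj_def scale_sum_right
    by (subst sum.swap) (simp add: mult.commute)
  finally show ?thesis .
qed

text \<open>After swapping the sums, \<open>sum_cocycle_V\<close> kills every group element except
  1. Consequently a vector annihilated by all \<open>F B\<close> is zero.\<close>

lemma sum_F:
  assumes s: "s \<in> rcarrier M"
  shows "(\<Sum>B\<in>V. F B s) = sc (of_nat (card V)) s"
proof -
  have "(\<Sum>B\<in>V. F B s) = (\<Sum>u\<in>U. sc (\<Sum>B\<in>V. cocycle B (iv u)) (act s u))"
    unfolding F_def scale_sum_left by (rule sum.swap)
  also have "\<dots> = (\<Sum>u\<in>U. if u = 1\<^sub>m n then sc (of_nat (card V)) s else 0)"
  proof (intro sum.cong refl)
    fix u assume u: "u \<in> U"
    have "iv u = 1\<^sub>m n \<longleftrightarrow> u = 1\<^sub>m n" using u inv_U by metis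
    then show "sc (\<Sum>B\<in>V. cocycle B (iv u)) (act s u) =
        (if u = 1\<^sub>m n then sc (of_nat (card V)) s else 0)"
      using u act_one[OF s] by (simp add: sum_cocycle_V inv_U)
  qed
  also have "\<dots> = sc (of_nat (card V)) s"
    using one_U finite_unitriangular[where 'a='a and n=n] by simp
  finally show ?thesis .
qed

text \<open>For fixed s the map [B] |-> \<open>F B s\<close> is a homomorphism of right modules: the
  formula is the one for [B] u, obtained by substituting v u^-1 for v and splitting the
  cocycle.\<close>

lemma act_F:
  assumes s: "s \<in> rcarrier M" and B: "B \<in> V" and u: "u \<in> U"
  shows "act (F B s) u = sc (cocycle B u) (F (dot_act n B u) s)"
proof -
  have "act (F B s) u = (\<Sum>v\<in>U. sc (cocycle B (iv v)) (act s (v * u)))"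
    unfolding F_def using s u
    by (subst act_sum) (simp_all add: scale_closed act_closed act_scale act_mult[symmetric])
  also have "\<dots> = (\<Sum>v\<in>U. sc (cocycle B (iv (v * iv u))) (act s v))"
    using sum_U_mult_right[OF u, of "\<lambda>v. sc (cocycle B (iv (v * iv u))) (act s v)"] u
    by (simp add: mult_inv_cancel)
  also have "\<dots> = (\<Sum>v\<in>U. sc (cocycle B u) (sc (cocycle (dot_act n B u) (iv v)) (act s v)))"
    using u B by (intro sum.cong refl) (simp add: inv_U cocycle_mult)
  finally show ?thesis by (simp only: F_def scale_sum_right)
qed

lemma F_in_weight_space:
  "s \<in> rcarrier M \<Longrightarrow> B \<in> V \<Longrightarrow> F B s \<in> weight_space B"
  by (auto simp: weight_space_def stabilizer_def F_closed act_F)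

lemma F_dot_act_eq_0:
  assumes "s \<in> rcarrier M" "B \<in> V" "u \<in> U" "F B s = 0"
  shows "F (dot_act n B u) s = 0"
  using act_F[OF assms(1-3)] assms cocycle_nonzero[of B u] by (simp add: act_zero)

text \<open>After the substitution v = u w the coefficient of t w is the sum in
  \<open>sum_cocycle_convolution\<close>, which selects the elements w that carry B to C. Distinct
  right orbits are therefore orthogonal.\<close>

lemma F_F_adj:
  assumes t: "t \<in> rcarrier M" and B: "B \<in> V" and C: "C \<in> V"
  shows "F C (F_adj B t) =
    sc (of_nat (card V)) (\<Sum>w\<in>{w \<in> U. dot_act n B w = C}. sc (cocycle C (iv w)) (act t w))"
proof -
  let ?c = "\<lambda>u. inverse (cocycle B (iv u))"
  have "F C (F_adj B t) = (\<Sum>v\<in>U. \<Sum>u\<in>U. sc (cocycle C (iv v) * ?c u) (act t (iv u * v)))"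
    unfolding F_def F_adj_def using t
    by (intro sum.cong refl)
       (simp add: act_sum scale_closed act_closed act_scale inv_U act_mult[symmetric] scale_sum_right)
  also have "\<dots> = (\<Sum>u\<in>U. \<Sum>v\<in>U. sc (cocycle C (iv v) * ?c u) (act t (iv u * v)))"
    by (rule sum.swap)
  also have "\<dots> = (\<Sum>u\<in>U. \<Sum>w\<in>U. sc (cocycle C (iv (u * w)) * ?c u) (act t w))"
  proof (rule sum.cong[OF refl])
    fix u assume u: "u \<in> U"
    show "(\<Sum>v\<in>U. sc (cocycle C (iv v) * ?c u) (act t (iv u * v))) =
      (\<Sum>w\<in>U. sc (cocycle C (iv (u * w)) * ?c u) (act t w))"
      using sum_U_mult_left[OF u, of "\<lambda>v. sc (cocycle C (iv v) * ?c u) (act t (iv u * v))"] u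
      by (simp add: mult_inv_cancel)
  qed
  also have "\<dots> = (\<Sum>w\<in>U. sc (\<Sum>u\<in>U. cocycle C (iv (u * w)) * ?c u) (act t w))"
    unfolding scale_sum_left by (rule sum.swap)
  also have "\<dots> = (\<Sum>w\<in>U. if dot_act n B w = C
      then sc (of_nat (card V)) (sc (cocycle C (iv w)) (act t w)) else 0)"
    by (intro sum.cong refl) (simp add: sum_cocycle_convolution[OF B C])
  also have "\<dots> = sc (of_nat (card V)) (\<Sum>w\<in>{w \<in> U. dot_act n B w = C}. sc (cocycle C (iv w)) (act t w))"
    by (auto simp: scale_sum_right sum.inter_filter finite_unitriangular intro!: sum.cong)
  finally show ?thesis .
qed

lemma F_F_adj_orthogonal:
  assumes "t \<in> rcarrier M" "B \<in> V" "C \<in> V" "\<And>w. w \<in> U \<Longrightarrow> dot_act n B w \<noteq> C"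
  shows "F C (F_adj B t) = 0"
proof -
  have none: "{w \<in> U. dot_act n B w = C} = {}" using assms(4) by auto
  show ?thesis by (simp only: F_F_adj[OF assms(1-3)] none sum.empty scale_zero_right)
qed

text \<open>Each w in the stabilizer returns t itself, because the cocycle at w^-1 is inverse to the
  weight at w. So \<open>F B\<close> inverts \<open>F_adj B\<close> on the psi_B-weight space up to
  a nonzero scalar.\<close>

lemma F_F_adj_same:
  assumes t: "t \<in> weight_space B" and B: "B \<in> V"
  shows "F B (F_adj B t) = sc (of_nat (card V) * of_nat (card (stabilizer B))) t"
proof -
  have "(\<Sum>w\<in>{w \<in> U. dot_act n B w = B}. sc (cocycle B (iv w)) (act t w)) =
    (\<Sum>w\<in>stabilizer B. t)"
  proof (intro sum.cong)
    fix w assume w: "w \<in> stabilizer B"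
    then have "cocycle B (iv w) * cocycle B w = 1"
      using cocycle_inv[OF B, of w] cocycle_nonzero[of B w] by (simp add: stabilizer_def)
    then show "sc (cocycle B (iv w)) (act t w) = t" using t w by (simp add: weight_space_def)
  qed (simp add: stabilizer_def)
  also have "\<dots> = sc (of_nat (card (stabilizer B))) t"
    by (simp add: scale_sum_left[symmetric] sum_constant_scale)
  finally show ?thesis using t B by (simp add: F_F_adj weight_space_def)
qed

text \<open>The left and the right action commute, and the left one is invertible.\<close>

lemma stabilizer_lact:
  assumes "A \<in> V" "x \<in> U"
  shows "stabilizer (lact x A) = stabilizer A"
proof -
  have "lact (iv x) (lact x B) = B" if "B \<in> V" for B
    using that assms by (simp add: lact_mult inv_U lact_one)
  then have "lact x (dot_act n A u) = lact x A \<longleftrightarrow> dot_act n A u = A" if "u \<in> U" for u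
    using that assms dot_act_closed by metis
  then show ?thesis using assms by (auto simp: stabilizer_def lact_dot_act[symmetric])
qed

text \<open>Replacing A by \<open>lact x A\<close> changes the exponent at 1 - u^-1 by the pairing
  of A with (x - 1)(1 - u^-1). This is the pairing of A - \<open>dot_act n A u\<close> with x - 1,
  which is zero when u fixes A, so the two linear characters coincide.\<close>

lemma weight_space_lact:
  assumes A: "A \<in> V" and x: "x \<in> U"
  shows "weight_space (lact x A) = weight_space A"
proof -
  have "cocycle (lact x A) u = cocycle A u" if u: "u \<in> stabilizer A" for u
  proof -
    have uU: "u \<in> U" and st: "dot_act n A u = A" using u by (auto simp: stabilizer_def)
    let ?y = "1\<^sub>m n - iv u" and ?z = "x - 1\<^sub>m n"
    have y: "?y \<in> V" "?z \<in> V" using uU x by (auto intro: unitriangular_diff_one inv_U)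
    have c: "?y \<in> carrier_mat n n" "?z \<in> carrier_mat n n" "x \<in> carrier_mat n n"
        "iv u \<in> carrier_mat n n" "A \<in> carrier_mat n n"
      using y x uU A by (simp_all add: UV_carrier_mat inv_U)
    have "pairing A (?z * iv u) = pairing A ?z"
      using pairing_dot_act[OF A uU y(2)] st by simp
    moreover have "?z * ?y = ?z - ?z * iv u"
      using mult_minus_distrib_mat[OF c(2) one_carrier_mat c(4)] c by simp
    ultimately have 0: "pairing A (?z * ?y) = 0"
      using c by (simp add: pairing_diff)
    have "x * ?y = ?y + ?z * ?y"
      unfolding minus_mult_distrib_mat[OF c(3) one_carrier_mat c(1)] using c by (intro eq_matI) auto
    then have "pairing A (x * ?y) = pairing A ?y"
      using c 0 by (simp add: pairing_add)
    then show ?thesis using pairing_lact[OF A x y(1)] by (simp add: cocycle_def)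
  qed
  then show ?thesis by (auto simp: weight_space_def stabilizer_lact[OF A x])
qed

end

section \<open>Fourier transforms over left orbits\<close>

context unitriangular_character
begin

lemma sum_V_U: "(\<Sum>y\<in>V. g y) = (\<Sum>h\<in>U. g (1\<^sub>m n - iv h))"
proof -
  have *: "1\<^sub>m n - (1\<^sub>m n - y) = y" if "y \<in> carrier_mat n n" for y :: "'a mat"
    using that by (intro eq_matI) auto
  have **: "1\<^sub>m n - y \<in> U" if "y \<in> V" for y
  proof -
    have "1\<^sub>m n - y = 1\<^sub>m n + (0\<^sub>m n n - y)"
      using strictly_lower_carrier_mat[OF that] by (intro eq_matI) auto
    then show ?thesis
      using that by (simp add: unitriangular_one_plus strictly_lower_closed)
  qed
  have "(\<Sum>y\<in>V. g y) = (\<Sum>u\<in>U. g (1\<^sub>m n - u))"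
    by (rule sum.reindex_bij_witness[where i="\<lambda>u. 1\<^sub>m n - u" and j="\<lambda>y. 1\<^sub>m n - y"])
       (simp_all add: * ** UV_carrier_mat unitriangular_diff_one)
  also have "\<dots> = (\<Sum>h\<in>U. g (1\<^sub>m n - iv h))"
    by (rule sum_U_inv[symmetric])
  finally show ?thesis .
qed

lemma sum_theta_pairing_inverse:
  assumes C: "C \<in> V"
  shows "(\<Sum>y\<in>V. inverse (\<theta> (pairing C y))) = (if C = 0\<^sub>m n n then of_nat (card V) else 0)"
proof -
  have Cc: "C \<in> carrier_mat n n" using C by (rule strictly_lower_carrier_mat)
  have "inverse (\<theta> (pairing C y)) = \<theta> (pairing (0\<^sub>m n n - C) y)" if "y \<in> V" for y
    using pairing_diff_left[OF zero_carrier_mat Cc strictly_lower_carrier_mat[OF that]]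
    by (simp add: theta_simps pairing_def[of "0\<^sub>m n n"])
  then have "(\<Sum>y\<in>V. inverse (\<theta> (pairing C y))) = (\<Sum>y\<in>V. \<theta> (pairing (0\<^sub>m n n - C) y))" by simp
  also have "\<dots> = (if 0\<^sub>m n n - C = 0\<^sub>m n n then of_nat (card V) else 0)"
    by (intro sum_theta_pairing strictly_lower_closed C)
  also have "0\<^sub>m n n - C = 0\<^sub>m n n \<longleftrightarrow> C = 0\<^sub>m n n"
  proof
    assume "0\<^sub>m n n - C = 0\<^sub>m n n"
    moreover have "0\<^sub>m n n - (0\<^sub>m n n - C) = C" using Cc by (intro eq_matI) auto
    moreover have "0\<^sub>m n n - 0\<^sub>m n n = (0\<^sub>m n n :: 'a mat)" by (intro eq_matI) auto
    ultimately show "C = 0\<^sub>m n n" by simp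
  qed (use Cc in auto)
  finally show ?thesis .
qed

text \<open>Along the left orbit of C, parametrised by 1 + z, the exponent at 1 - h^-1 is affine in
  z with linear part given by C - \<open>dot_act n C h\<close>. The linear part is trivial exactly
  when h fixes C, so summing over the orbit detects the stabilizer.\<close>

lemma pairing_lact_coboundary:
  assumes C: "C \<in> V" and h: "h \<in> U" and z: "z \<in> V"
  shows "pairing (lact (1\<^sub>m n + z) C) (1\<^sub>m n - iv h) =
    pairing C (1\<^sub>m n - iv h) + pairing (C - dot_act n C h) z"
proof -
  let ?y = "1\<^sub>m n - iv h"
  have y: "?y \<in> V" "1\<^sub>m n + z \<in> U" using h z by (auto intro: unitriangular_diff_one unitriangular_one_plus inv_U)
  have c: "C \<in> carrier_mat n n" "?y \<in> carrier_mat n n" "z \<in> carrier_mat n n"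
      "iv h \<in> carrier_mat n n" "dot_act n C h \<in> carrier_mat n n" "z * iv h \<in> carrier_mat n n"
    using C h y z by (auto simp: UV_carrier_mat inv_U dot_act_closed strictly_lower_mult)
  have "pairing (lact (1\<^sub>m n + z) C) ?y = pairing C ((1\<^sub>m n + z) * ?y)"
    by (rule pairing_lact[OF C y(2,1)])
  also have "(1\<^sub>m n + z) * ?y = ?y + (z - z * iv h)"
    unfolding add_mult_distrib_mat[OF one_carrier_mat c(3,2)]
      mult_minus_distrib_mat[OF c(3) one_carrier_mat c(4)] using c by simp
  also have "pairing C (?y + (z - z * iv h)) = pairing C ?y + (pairing C z - pairing C (z * iv h))"
    using c by (simp add: pairing_add[OF c(1,2) minus_carrier_mat[OF c(6)]] pairing_diff[OF c(1,3,6)])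
  also have "pairing C (z * iv h) = pairing (dot_act n C h) z"
    using C h z by (simp add: pairing_dot_act)
  also have "pairing C z - pairing (dot_act n C h) z = pairing (C - dot_act n C h) z"
    by (rule pairing_diff_left[OF c(1,5,3), symmetric])
  finally show ?thesis .
qed

text \<open>The sum over z of the linear part is an orthogonality sum. Up to the factor |V| the
  result is psi_C extended by zero. Inverses play the role of complex conjugates, as the values of
  \<theta> are roots of unity.\<close>

lemma sum_left_orbit:
  assumes C: "C \<in> V" and h: "h \<in> U"
  shows "(\<Sum>x\<in>U. \<theta> (pairing (lact x C) (1\<^sub>m n - iv h))) =
      (if h \<in> stabilizer C then of_nat (card V) * cocycle C h else 0)"
    and "(\<Sum>x\<in>U. inverse (\<theta> (pairing (lact x C) (1\<^sub>m n - iv h)))) =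
      (if h \<in> stabilizer C then of_nat (card V) * inverse (cocycle C h) else 0)"
proof -
  let ?E = "C - dot_act n C h"
  have c: "C \<in> carrier_mat n n" "dot_act n C h \<in> carrier_mat n n"
    using C h by (auto simp: UV_carrier_mat dot_act_closed)
  have E: "?E \<in> V" using C h by (intro strictly_lower_closed dot_act_closed)
  have E0: "?E = 0\<^sub>m n n \<longleftrightarrow> h \<in> stabilizer C"
  proof
    assume "?E = 0\<^sub>m n n"
    moreover have "?E + dot_act n C h = C" using c by (intro eq_matI) auto
    ultimately have "dot_act n C h = C" using c by simp
    then show "h \<in> stabilizer C" using h by (simp add: stabilizer_def)
  qed (use c in \<open>auto simp: stabilizer_def\<close>)
  have "(\<Sum>x\<in>U. \<theta> (pairing (lact x C) (1\<^sub>m n - iv h))) =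
    (\<Sum>z\<in>V. cocycle C h * \<theta> (pairing ?E z))"
    by (subst sum_U_V) (simp add: pairing_lact_coboundary C h cocycle_def theta_simps)
  then show "(\<Sum>x\<in>U. \<theta> (pairing (lact x C) (1\<^sub>m n - iv h))) =
      (if h \<in> stabilizer C then of_nat (card V) * cocycle C h else 0)"
    by (simp add: sum_distrib_left[symmetric] sum_theta_pairing[OF E] E0)
  have "(\<Sum>x\<in>U. inverse (\<theta> (pairing (lact x C) (1\<^sub>m n - iv h)))) =
    (\<Sum>z\<in>V. inverse (cocycle C h) * inverse (\<theta> (pairing ?E z)))"
    by (subst sum_U_V) (simp add: pairing_lact_coboundary C h cocycle_def theta_simps)
  then show "(\<Sum>x\<in>U. inverse (\<theta> (pairing (lact x C) (1\<^sub>m n - iv h)))) =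
      (if h \<in> stabilizer C then of_nat (card V) * inverse (cocycle C h) else 0)"
    by (simp add: sum_distrib_left[symmetric] sum_theta_pairing_inverse[OF E] E0)
qed

text \<open>Parseval: the linear characters of the two stabilizers, extended by zero, have Fourier
  transforms supported on the two left orbits, so if these orbits are disjoint, the product of
  one with the inverse of the other sums to zero.\<close>

lemma left_orbits_meet:
  assumes C: "C \<in> V" and D: "D \<in> V"
    and eq: "\<And>h. h \<in> stabilizer C \<inter> stabilizer D \<Longrightarrow> cocycle C h = cocycle D h"
  shows "\<exists>x\<in>U. \<exists>z\<in>U. lact x C = lact z D"
proof (rule ccontr)
  assume disj: "\<not> ?thesis"
  let ?T = "\<lambda>x B y. \<theta> (pairing (lact x B) y)"
  let ?H = "stabilizer C \<inter> stabilizer D"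
  \<comment> \<open>Expanding the product gives additive characters of V indexed by differences of
    points of the two left orbits. If the orbits are disjoint, no difference is zero and every sum
    over y vanishes.\<close>
  have "(\<Sum>y\<in>V. (\<Sum>x\<in>U. ?T x C y) * (\<Sum>z\<in>U. inverse (?T z D y))) =
    (\<Sum>y\<in>V. \<Sum>x\<in>U. \<Sum>z\<in>U. \<theta> (pairing (lact x C - lact z D) y))"
  proof (rule sum.cong[OF refl])
    fix y assume y: "y \<in> V"
    have "?T x C y * inverse (?T z D y) = \<theta> (pairing (lact x C - lact z D) y)"
      if "x \<in> U" "z \<in> U" for x z
      using that C D y
      by (simp add: pairing_diff_left UV_carrier_mat lact_closed theta_simps divide_inverse)
    then show "(\<Sum>x\<in>U. ?T x C y) * (\<Sum>z\<in>U. inverse (?T z D y)) =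
        (\<Sum>x\<in>U. \<Sum>z\<in>U. \<theta> (pairing (lact x C - lact z D) y))"
      by (simp add: sum_product)
  qed
  also have "\<dots> = (\<Sum>x\<in>U. \<Sum>y\<in>V. \<Sum>z\<in>U. \<theta> (pairing (lact x C - lact z D) y))"
    by (rule sum.swap)
  also have "\<dots> = (\<Sum>x\<in>U. \<Sum>z\<in>U. \<Sum>y\<in>V. \<theta> (pairing (lact x C - lact z D) y))"
    by (intro sum.cong refl sum.swap)
  also have "\<dots> = 0"
  proof (rule sum.neutral, rule ballI, rule sum.neutral, rule ballI)
    fix x z assume xz: "x \<in> U" "z \<in> U"
    have c: "lact x C \<in> carrier_mat n n" "lact z D \<in> carrier_mat n n"
      using xz C D by (simp_all add: UV_carrier_mat lact_closed)
    have "lact x C - lact z D \<noteq> 0\<^sub>m n n"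
    proof
      assume "lact x C - lact z D = 0\<^sub>m n n"
      moreover have "lact x C - lact z D + lact z D = lact x C" using c by (intro eq_matI) auto
      ultimately have "lact x C = lact z D" using c by simp
      then show False using disj xz by blast
    qed
    moreover have "lact x C - lact z D \<in> V"
      using xz C D by (intro strictly_lower_closed lact_closed)
    ultimately show "(\<Sum>y\<in>V. \<theta> (pairing (lact x C - lact z D) y)) = 0"
      by (simp add: sum_theta_pairing)
  qed
  finally have "0 = (\<Sum>h\<in>U. (\<Sum>x\<in>U. ?T x C (1\<^sub>m n - iv h)) * (\<Sum>z\<in>U. inverse (?T z D (1\<^sub>m n - iv h))))"
    by (subst (asm) sum_V_U) simp
  \<comment> \<open>The same sum with y = 1 - h^-1: only the common stabilizer contributes, and
    there psi_C and psi_D cancel, leaving |V|^2 for each h. Since 1 lies in both stabilizers, the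
    total is not zero.\<close>
  also have "\<dots> = (\<Sum>h\<in>U. if h \<in> ?H then (of_nat (card V))\<^sup>2 else 0)"
  proof (rule sum.cong[OF refl])
    fix h assume h: "h \<in> U"
    show "(\<Sum>x\<in>U. ?T x C (1\<^sub>m n - iv h)) * (\<Sum>z\<in>U. inverse (?T z D (1\<^sub>m n - iv h))) =
        (if h \<in> ?H then (of_nat (card V))\<^sup>2 else 0)"
      using eq[of h] cocycle_nonzero[of D h]
      by (simp add: sum_left_orbit[OF C h] sum_left_orbit[OF D h] power2_eq_square)
  qed
  also have "\<dots> = (\<Sum>h\<in>?H. (of_nat (card V))\<^sup>2)"
    by (rule sum.mono_neutral_cong_right) (auto simp: finite_unitriangular stabilizer_def)
  finally have "of_nat (card ?H) * (of_nat (card V))\<^sup>2 = (0 :: complex)" by simp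
  moreover have "card ?H \<noteq> 0" "card V \<noteq> 0"
    using stabilizer_one[OF C] stabilizer_one[OF D] finite_stabilizer[of C] C finite_strictly_lower
    by (auto simp: card_eq_0_iff)
  ultimately show False by simp
qed

subsection \<open>The orbit modules\<close>

lemma vector_space_fun_scale: "vector_space (fun_scale :: complex \<Rightarrow> ('b \<Rightarrow> complex) \<Rightarrow> _)"
  by unfold_locales (auto simp: fun_scale_def fun_eq_iff algebra_simps)

lemma sum_apply: "(\<Sum>i\<in>I. f i) x = (\<Sum>i\<in>I. f i x :: complex)"
  by (induction I rule: infinite_finite_induct) auto

definition orbit :: "'a mat \<Rightarrow> 'a mat set" where
  "orbit A = dot_act n A ` U"

lemma orbit_subset: "A \<in> V \<Longrightarrow> orbit A \<subseteq> V"
  by (auto simp: orbit_def dot_act_closed)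

lemma orbit_self: "A \<in> V \<Longrightarrow> A \<in> orbit A"
  unfolding orbit_def by (rule image_eqI[of _ _ "1\<^sub>m n"]) (simp_all add: dot_act_one one_U)

lemma finite_orbit: "finite (orbit A)"
  by (simp add: orbit_def finite_unitriangular)

text \<open>Since u permutes V, only the preimage of D under u contributes to the coefficient of
  [D].\<close>

lemma E_module_act:
  assumes "D \<in> V" "u \<in> U"
  shows "ract (E_module n \<theta>) f u D = f (dot_act n D (iv u)) * cocycle (dot_act n D (iv u)) u"
proof -
  have "ract (E_module n \<theta>) f u D =
    (\<Sum>A\<in>V. f A * chi \<theta> A (1\<^sub>m n - iv u) * (if D = dot_act n A u then 1 else 0))"
    by (simp add: E_module_def sum_apply fun_scale_def basis_elt_def)
  also have "\<dots> = (\<Sum>A\<in>V. if A = dot_act n D (iv u) then f A * cocycle A u else 0)"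
  proof (rule sum.cong[OF refl])
    fix A assume A: "A \<in> V"
    have "D = dot_act n A u \<longleftrightarrow> A = dot_act n D (iv u)"
      using dot_act_eq_iff[OF A assms] by auto
    then show "f A * chi \<theta> A (1\<^sub>m n - iv u) * (if D = dot_act n A u then 1 else 0) =
      (if A = dot_act n D (iv u) then f A * cocycle A u else 0)"
      using A by (simp add: chi_pairing UV_carrier_mat cocycle_def)
  qed
  also have "\<dots> = f (dot_act n D (iv u)) * cocycle (dot_act n D (iv u)) u"
    using assms by (simp add: finite_strictly_lower dot_act_closed inv_U)
  finally show ?thesis .
qed

lemma E_module_act_outside:
  assumes "D \<notin> V" "u \<in> U"
  shows "ract (E_module n \<theta>) f u D = 0"
  using assms dot_act_closed[of _ u]
  by (auto simp: E_module_def sum_apply fun_scale_def basis_elt_def intro!: sum.neutral)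

lemma orbit_module_simps [simp]:
  "rscale (orbit_module n \<theta> A) = fun_scale"
  "ract (orbit_module n \<theta> A) = ract (E_module n \<theta>)"
  by (simp_all add: orbit_module_def E_module_def)

lemma orbit_module_carrier:
  "rcarrier (orbit_module n \<theta> A) = {f. \<forall>D. D \<notin> orbit A \<longrightarrow> f D = 0}" (is "_ = ?R")
proof -
  interpret vector_space "fun_scale :: complex \<Rightarrow> ('a mat \<Rightarrow> complex) \<Rightarrow> _"
    by (rule vector_space_fun_scale)
  have ro: "right_orbit n A = basis_elt ` orbit A"
    by (auto simp: right_orbit_def orbit_def)
  have "span (basis_elt ` orbit A) = ?R"
  proof
    have "subspace ?R" by (intro subspaceI) (auto simp: fun_scale_def)
    then show "span (basis_elt ` orbit A) \<subseteq> ?R"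
      by (intro span_minimal) (auto simp: basis_elt_def)
    show "?R \<subseteq> span (basis_elt ` orbit A)"
    proof
      fix f assume f: "f \<in> ?R"
      have "f = (\<Sum>D\<in>orbit A. fun_scale (f D) (basis_elt D))"
      proof
        fix B
        have "(\<Sum>D\<in>orbit A. fun_scale (f D) (basis_elt D)) B =
          (\<Sum>D\<in>orbit A. if D = B then f B else 0)"
          unfolding sum_apply by (intro sum.cong) (auto simp: fun_scale_def basis_elt_def)
        also have "\<dots> = f B" using f finite_orbit by simp
        finally show "f B = (\<Sum>D\<in>orbit A. fun_scale (f D) (basis_elt D)) B" by simp
      qed
      also have "\<dots> \<in> span (basis_elt ` orbit A)"
        by (intro span_sum span_scale span_base imageI)
      finally show "f \<in> span (basis_elt ` orbit A)" .
    qed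
  qed
  then show ?thesis by (simp add: orbit_module_def ro)
qed

lemma basis_elt_act:
  assumes "A \<in> V" "u \<in> U"
  shows "ract (E_module n \<theta>) (basis_elt A) u = fun_scale (cocycle A u) (basis_elt (dot_act n A u))"
proof
  fix D
  show "ract (E_module n \<theta>) (basis_elt A) u D =
      fun_scale (cocycle A u) (basis_elt (dot_act n A u)) D"
  proof (cases "D \<in> V")
    case True
    have "dot_act n D (iv u) = A \<longleftrightarrow> D = dot_act n A u"
      using dot_act_eq_iff[OF assms(1) True assms(2)] by auto
    then show ?thesis
      using assms by (auto simp: E_module_act[OF True] basis_elt_def fun_scale_def)
  next
    case False
    then show ?thesis
      using assms dot_act_closed[OF assms] by (auto simp: E_module_act_outside basis_elt_def fun_scale_def)
  qed
qed

lemma E_module_act_sum: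
  assumes "u \<in> U"
  shows "ract (E_module n \<theta>) (\<Sum>i\<in>I. f i) u = (\<Sum>i\<in>I. ract (E_module n \<theta>) (f i) u)"
proof
  fix D
  show "ract (E_module n \<theta>) (\<Sum>i\<in>I. f i) u D = (\<Sum>i\<in>I. ract (E_module n \<theta>) (f i) u) D"
    by (cases "D \<in> V")
       (simp_all add: sum_apply E_module_act E_module_act_outside assms sum_distrib_right)
qed

text \<open>The embedding makes s a nonzero function on the right orbit of A. At a point D of its
  support, an h fixing both C and D multiplies the value by psi_C(h), as s is a weight vector, and
  by psi_D(h), by the formula for the action. So the characters agree on the common stabilizer, and
  the left orbits of C and D meet.\<close>

lemma weight_space_in_biorbit:
  fixes S :: "('a mat, 's::ab_group_add) rmod"
  assumes S: "unitriangular_module n \<theta> S" and A: "A \<in> V" and C: "C \<in> V"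
    and f: "rmod_hom G S (orbit_module n \<theta> A) f" "inj_on f (rcarrier S)"
    and s: "s \<in> unitriangular_module.weight_space n \<theta> S C" "s \<noteq> 0"
  shows "\<exists>x\<in>U. C \<in> orbit (lact x A)"
proof -
  interpret S: unitriangular_module n \<theta> S by fact
  have sS: "s \<in> rcarrier S" using s by (simp add: S.weight_space_def)
  have "f 0 = 0"
    using S.hom_zero[OF f(1)] by (simp add: vector_space_fun_scale)
  then have "f s \<noteq> 0" using f(2) s sS S.zero_closed by (metis inj_onD)
  then obtain D where D: "f s D \<noteq> 0" by (auto simp: fun_eq_iff)
  have "f s \<in> rcarrier (orbit_module n \<theta> A)" using f(1) sS by (auto simp: rmod_hom_def)
  then have Do: "D \<in> orbit A" using D by (auto simp: orbit_module_carrier)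
  then have DV: "D \<in> V" using orbit_subset[OF A] by auto
  have "cocycle C h = cocycle D h" if h: "h \<in> stabilizer C \<inter> stabilizer D" for h
  proof -
    have hU: "h \<in> U" and hD: "dot_act n D (iv h) = D"
      using h dot_act_eq_iff[OF DV DV, of h] by (auto simp: stabilizer_def)
    have "f (ract S s h) = ract (E_module n \<theta>) (f s) h"
      using f(1) sS hU by (simp add: rmod_hom_def)
    moreover have "ract S s h = rscale S (cocycle C h) s"
      using s h by (simp add: S.weight_space_def)
    moreover have "f (rscale S (cocycle C h) s) = fun_scale (cocycle C h) (f s)"
      using f(1) sS by (simp add: rmod_hom_def)
    ultimately have "ract (E_module n \<theta>) (f s) h = fun_scale (cocycle C h) (f s)" by simp
    then have "cocycle C h * f s D = f s D * cocycle D h"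
      using E_module_act[OF DV hU, of "f s"] hD by (simp add: fun_scale_def)
    then show ?thesis using D by simp
  qed
  then obtain x z where xz: "x \<in> U" "z \<in> U" "lact x C = lact z D"
    using left_orbits_meet[OF C DV] by blast
  obtain u where u: "u \<in> U" "D = dot_act n A u" using Do by (auto simp: orbit_def)
  have "C = lact (iv x) (lact x C)"
    using xz(1) C by (simp add: lact_mult inv_U lact_one)
  also have "\<dots> = lact (z * iv x) (dot_act n A u)"
    using xz u A by (simp add: lact_mult inv_U dot_act_closed)
  also have "\<dots> = dot_act n (lact (z * iv x) A) u"
    using xz u A by (simp add: lact_dot_act inv_U unitriangular_closed)
  finally have "C \<in> orbit (lact (z * iv x) A)" using u by (simp add: orbit_def)
  then show ?thesis using xz by (meson inv_U(1) unitriangular_closed)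
qed

section \<open>Right orbits that meet a left orbit\<close>

definition left_orbit :: "'a mat \<Rightarrow> 'a mat set" where
  "left_orbit A = (\<lambda>x. lact x A) ` U"

lemma left_orbit_subset: "A \<in> V \<Longrightarrow> left_orbit A \<subseteq> V"
  by (auto simp: left_orbit_def lact_closed)

lemma finite_left_orbit: "finite (left_orbit A)"
  by (simp add: left_orbit_def finite_unitriangular)

lemma orbit_eq:
  assumes A: "A \<in> V" and B: "B \<in> orbit A"
  shows "orbit B = orbit A"
proof -
  obtain u where u: "u \<in> U" "B = dot_act n A u" using B by (auto simp: orbit_def)
  have "orbit B = (\<lambda>v. dot_act n A (u * v)) ` U"
    using u A by (auto simp: orbit_def dot_act_mult)
  also have "\<dots> = dot_act n A ` ((\<lambda>v. u * v) ` U)" by (simp add: image_image)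
  also have "(\<lambda>v. u * v) ` U = U"
  proof
    show "U \<subseteq> (\<lambda>v. u * v) ` U"
    proof
      fix w assume "w \<in> U"
      then show "w \<in> (\<lambda>v. u * v) ` U"
        using u by (intro image_eqI[of _ _ "iv u * w"]) (simp_all add: mult_inv_cancel unitriangular_closed inv_U)
    qed
  qed (use u in \<open>auto simp: unitriangular_closed\<close>)
  finally show ?thesis by (simp add: orbit_def)
qed

text \<open>Acting by x from the left permutes the left orbit of A and, since the actions commute,
  carries the right orbit of A to that of \<open>lact x A\<close>.\<close>

lemma card_left_orbit_inter_orbit:
  assumes A: "A \<in> V" and x: "x \<in> U"
  shows "card (left_orbit A \<inter> orbit (lact x A)) = card (left_orbit A \<inter> orbit A)"
proof -
  have st: "lact x ` (left_orbit A \<inter> orbit A) \<subseteq> left_orbit A \<inter> orbit (lact x A)" if "x \<in> U" "A \<in> V" for x A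
  proof
    fix C assume "C \<in> lact x ` (left_orbit A \<inter> orbit A)"
    then obtain y u where "y \<in> U" "u \<in> U" "C = lact x (lact y A)" "C = lact x (dot_act n A u)"
      by (auto simp: left_orbit_def orbit_def)
    then have "C = lact (y * x) A" "y * x \<in> U" "C = dot_act n (lact x A) u"
      using that by (simp_all add: lact_mult lact_dot_act unitriangular_closed)
    with \<open>u \<in> U\<close> show "C \<in> left_orbit A \<inter> orbit (lact x A)"
      unfolding left_orbit_def orbit_def by blast
  qed
  have l: "left_orbit (lact x A) = left_orbit A"
  proof -
    have "lact y A \<in> left_orbit (lact x A)" if y: "y \<in> U" for y
      using that A x unfolding left_orbit_def
      by (intro image_eqI[of _ _ "iv x * y"]) (simp_all add: lact_mult unitriangular_closed inv_U mult_inv_cancel)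
    then show ?thesis using A x by (auto simp: left_orbit_def lact_mult unitriangular_closed)
  qed
  have inv: "lact (iv x) (lact x B) = B" "lact x (lact (iv x) B) = B" if "B \<in> V" for B
    using that x by (simp_all add: lact_mult inv_U lact_one)
  have "bij_betw (lact x) (left_orbit A \<inter> orbit A) (left_orbit A \<inter> orbit (lact x A))"
  proof (rule bij_betw_byWitness[where f'="lact (iv x)"])
    show "\<forall>B\<in>left_orbit A \<inter> orbit A. lact (iv x) (lact x B) = B"
      using inv left_orbit_subset[OF A] by auto
    show "\<forall>B\<in>left_orbit A \<inter> orbit (lact x A). lact x (lact (iv x) B) = B"
      using inv left_orbit_subset[OF A] by auto
    show "lact x ` (left_orbit A \<inter> orbit A) \<subseteq> left_orbit A \<inter> orbit (lact x A)"
      by (rule st[OF x A])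
    have "lact (iv x) ` (left_orbit (lact x A) \<inter> orbit (lact x A)) \<subseteq>
        left_orbit (lact x A) \<inter> orbit (lact (iv x) (lact x A))"
      using A x by (intro st) (simp_all add: inv_U lact_closed)
    then show "lact (iv x) ` (left_orbit A \<inter> orbit (lact x A)) \<subseteq> left_orbit A \<inter> orbit A"
      by (simp add: l inv(1)[OF A])
  qed
  then show ?thesis by (simp add: bij_betw_same_card)
qed

text \<open>All right orbits that meet the left orbit of A cut out parts of equal size, so their
  number is a quotient of two cardinalities.\<close>

lemma orbit_transversal:
  assumes A: "A \<in> V"
  obtains I where "I \<subseteq> left_orbit A" "finite I"
    and "\<And>B. B \<in> left_orbit A \<Longrightarrow> \<exists>C\<in>I. B \<in> orbit C"
    and "\<And>B C. B \<in> I \<Longrightarrow> C \<in> I \<Longrightarrow> C \<in> orbit B \<Longrightarrow> B = C"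
    and "card I * card (left_orbit A \<inter> orbit A) = card (left_orbit A)"
proof -
  let ?L = "left_orbit A"
  \<comment> \<open>The choice depends on B only through its right orbit, so \<open>r\<close>
    selects one representative per orbit, and its fibres are the parts into which the right orbits
    cut the left orbit.\<close>
  define r where "r = (\<lambda>B. SOME C. C \<in> ?L \<and> orbit C = orbit B)"
  have r: "r B \<in> ?L" "orbit (r B) = orbit B" if "B \<in> ?L" for B
    using someI[of "\<lambda>C. C \<in> ?L \<and> orbit C = orbit B" B] that by (auto simp: r_def)
  have rc: "r B = r C" if "orbit B = orbit C" for B C using that by (simp add: r_def)
  have LV: "B \<in> V" if "B \<in> ?L" for B using that left_orbit_subset[OF A] by auto
  define I where "I = r ` ?L"
  have rI: "r i = i" if "i \<in> I" for i
  proof -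
    obtain B where "B \<in> ?L" "i = r B" using \<open>i \<in> I\<close> by (auto simp: I_def)
    then show ?thesis using rc[OF r(2)] by simp
  qed
  have fib: "{B \<in> ?L. r B = i} = ?L \<inter> orbit i" if i: "i \<in> I" for i
  proof -
    have iL: "i \<in> ?L" using i r by (auto simp: I_def)
    have "r B = i \<longleftrightarrow> B \<in> orbit i" if B: "B \<in> ?L" for B
    proof
      assume "r B = i"
      then have "orbit B = orbit i" using r(2)[OF B] by simp
      then show "B \<in> orbit i" using orbit_self[OF LV[OF B]] by simp
    next
      assume "B \<in> orbit i"
      then have "r B = r i" by (intro rc orbit_eq LV iL)
      then show "r B = i" by (simp add: rI[OF i])
    qed
    then show ?thesis by auto
  qed
  have "card ?L = (\<Sum>i\<in>I. card {B \<in> ?L. r B = i})"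
    using sum.image_gen[OF finite_left_orbit[of A], of "\<lambda>_. 1::nat" r] by (simp add: I_def)
  also have "\<dots> = (\<Sum>i\<in>I. card (?L \<inter> orbit A))"
  proof (rule sum.cong[OF refl])
    fix i assume i: "i \<in> I"
    then have "i \<in> ?L" using r by (auto simp: I_def)
    then obtain x where "x \<in> U" "i = lact x A" by (auto simp: left_orbit_def)
    then show "card {B \<in> ?L. r B = i} = card (?L \<inter> orbit A)"
      unfolding fib[OF i] by (simp add: card_left_orbit_inter_orbit[OF A])
  qed
  finally have "card I * card (?L \<inter> orbit A) = card ?L" by simp
  moreover have "B = C" if "B \<in> I" "C \<in> I" "C \<in> orbit B" for B C
  proof -
    have "B \<in> ?L" using r(1) that(1) by (auto simp: I_def)
    then have "r C = r B" by (intro rc orbit_eq LV that(3))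
    then show ?thesis using rI that by simp
  qed
  moreover have "\<exists>C\<in>I. B \<in> orbit C" if "B \<in> ?L" for B
    using that r[OF that] orbit_self[OF LV[OF that]] by (auto simp: I_def)
  moreover have "I \<subseteq> ?L" using r by (auto simp: I_def)
  ultimately show ?thesis using that finite_left_orbit finite_subset by blast
qed

text \<open>The components of \<open>[A]\<close> in the summands isomorphic to \<open>S\<close> give a basis \<open>s l\<close> of the weight
  space of \<open>A\<close> in \<open>S\<close>, and then the \<open>F_adj i (s l)\<close> with \<open>i \<in> I\<close> are a basis of \<open>S\<close>.\<close>

lemma rdim_eq_card_mult:
  fixes S :: "('a mat, 's::ab_group_add) rmod"
  assumes A: "A \<in> V"
    and S: "irreducible_module G S"
    and emb: "rmod_hom G S (orbit_module n \<theta> A) e" "inj_on e (rcarrier S)"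
    and dec: "decomposition G (orbit_module n \<theta> A) k W"
    and I: "I \<subseteq> left_orbit A" "finite I" "\<And>B. B \<in> left_orbit A \<Longrightarrow> \<exists>C\<in>I. B \<in> orbit C"
      "\<And>B C. B \<in> I \<Longrightarrow> C \<in> I \<Longrightarrow> C \<in> orbit B \<Longrightarrow> B = C"
  shows "rdim S = card I * card {l. l < k \<and> module_iso G S ((orbit_module n \<theta> A)\<lparr>rcarrier := W l\<rparr>)}"
proof -
  interpret S: unitriangular_module n \<theta> S
    using S \<theta> group_unitriangular
    by unfold_locales (simp_all add: irreducible_module_def)
  let ?M = "orbit_module n \<theta> A"
  let ?N = "\<lambda>l. ?M\<lparr>rcarrier := W l\<rparr>"
  let ?act = "ract (E_module n \<theta>)"
  let ?L = "{l. l < k \<and> module_iso G S (?N l)}"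
  interpret fs: vector_space "fun_scale :: complex \<Rightarrow> ('a mat \<Rightarrow> complex) \<Rightarrow> _"
    by (rule vector_space_fun_scale)
  have irr: "irreducible_module G (?N l)" and sub: "W l \<subseteq> rcarrier ?M" if "l < k" for l
    using dec that by (auto simp: decomposition_def submodule_on_def)
  have N: "right_mod G (?N l)" if "l < k" for l
    using irr[OF that] by (intro right_modI) (simp add: irreducible_module_def)
  note N_closed = right_mod.scale_closed[OF N, simplified] right_mod.act_closed[OF N, simplified]
    right_mod.sum_closed[OF N, simplified] right_mod.zero_closed[OF N, simplified]
  have bij: "bij_betw (\<lambda>x. \<Sum>l<k. x l) (Pi\<^sub>E {..<k} W) (rcarrier ?M)"
    using dec by (simp add: decomposition_def)
  have uniq: "\<forall>l<k. x l = y l"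
    if "(\<Sum>l<k. x l) = (\<Sum>l<k. y l)" "\<And>l. l < k \<Longrightarrow> x l \<in> W l" "\<And>l. l < k \<Longrightarrow> y l \<in> W l" for x y
  proof -
    have "restrict x {..<k} = restrict y {..<k}"
    proof (rule inj_onD[OF bij_betw_imp_inj_on[OF bij]])
      show "(\<Sum>l<k. restrict x {..<k} l) = (\<Sum>l<k. restrict y {..<k} l)"
        using that(1) by simp
    qed (use that in auto)
    then show ?thesis by (metis lessThan_iff restrict_apply')
  qed
  have "basis_elt A \<in> rcarrier ?M"
    using orbit_self[OF A] by (auto simp: orbit_module_carrier basis_elt_def)
  then obtain w where w: "w \<in> Pi\<^sub>E {..<k} W" "(\<Sum>l<k. w l) = basis_elt A"
    using bij_betw_imp_surj_on[OF bij] by (metis (no_types, lifting) imageE)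
  have wW: "w l \<in> W l" if "l < k" for l using w(1) that by auto
  \<comment> \<open>[A] is a psi_A-weight vector; comparing components in the direct sum, each
    \<open>w l\<close> is one as well.\<close>
  have w_act: "?act (w l) h = fun_scale (cocycle A h) (w l)" if "h \<in> stabilizer A" "l < k" for h l
  proof -
    have hU: "h \<in> U" using that by (simp add: stabilizer_def)
    have "(\<Sum>l<k. ?act (w l) h) = (\<Sum>l<k. fun_scale (cocycle A h) (w l))"
      using that hU A
      by (simp add: E_module_act_sum[symmetric] fs.scale_sum_right[symmetric] w(2) basis_elt_act
          stabilizer_def)
    then have "\<forall>l<k. ?act (w l) h = fun_scale (cocycle A h) (w l)"
      by (rule uniq) (simp_all add: N_closed wW hU)
    then show ?thesis using that by simp
  qed
  have ex: "\<exists>f. bij_betw f (rcarrier S) (W l) \<and> rmod_hom G S (?N l) f" if l: "l \<in> ?L" for l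
  proof -
    obtain f where f: "bij_betw f (rcarrier S) (rcarrier (?N l))"
        "\<forall>v\<in>rcarrier S. \<forall>w\<in>rcarrier S. f (v + w) = f v + f w"
        "\<forall>c. \<forall>v\<in>rcarrier S. f (rscale S c v) = rscale (?N l) c (f v)"
        "\<forall>v\<in>rcarrier S. \<forall>g\<in>U. f (ract S v g) = ract (?N l) (f v) g"
      using l unfolding module_iso_def by blast
    then have "rmod_hom G S (?N l) f"
      using bij_betw_imp_surj_on[OF f(1)] by (auto simp: rmod_hom_def)
    with f(1) show ?thesis by auto
  qed
  have "\<exists>f. \<forall>l\<in>?L. bij_betw (f l) (rcarrier S) (W l) \<and> rmod_hom G S (?N l) (f l)"
    by (intro bchoice ballI ex)
  then obtain f where f: "\<And>l. l \<in> ?L \<Longrightarrow> bij_betw (f l) (rcarrier S) (W l)"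
      "\<And>l. l \<in> ?L \<Longrightarrow> rmod_hom G S (?N l) (f l)" by blast
  define s where "s l = inv_into (rcarrier S) (f l) (w l)" for l
  have s: "s l \<in> rcarrier S" "f l (s l) = w l" if "l \<in> ?L" for l
    using bij_betw_imp_surj_on[OF f(1)[OF that]] wW[of l] that
    by (simp_all add: s_def inv_into_into f_inv_into_f)
  have f_act: "f l (ract S v g) = ?act (f l v) g" "f l (rscale S c v) = fun_scale c (f l v)"
    if "l \<in> ?L" "v \<in> rcarrier S" "g \<in> U" for l v g c
    using f(2)[OF that(1)] that by (simp_all add: rmod_hom_def)
  have f_sum: "f l (\<Sum>i\<in>J. x i) = (\<Sum>i\<in>J. f l (x i))"
    if "l \<in> ?L" "\<And>i. i \<in> J \<Longrightarrow> x i \<in> rcarrier S" for l x and J :: "'a mat set"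
    using S.hom_sum[OF f(2)[OF that(1)] _ that(2)] by (simp add: vector_space_fun_scale)
  have f0: "f l 0 = 0" if "l \<in> ?L" for l
    using S.hom_zero[OF f(2)[OF that]] by (simp add: vector_space_fun_scale)
  have f_inj: "x = y" if "f l x = f l y" "l \<in> ?L" "x \<in> rcarrier S" "y \<in> rcarrier S" for l x y
    using inj_onD[OF bij_betw_imp_inj_on[OF f(1)[OF that(2)]] that(1,3,4)] .
  have s_wt: "s l \<in> S.weight_space A" if l: "l \<in> ?L" for l
    unfolding S.weight_space_def
  proof (intro CollectI conjI ballI)
    show "s l \<in> rcarrier S" by (rule s(1)[OF l])
    fix h assume h: "h \<in> stabilizer A"
    then have hU: "h \<in> U" by (simp add: stabilizer_def)
    have "f l (ract S (s l) h) = f l (rscale S (cocycle A h) (s l))"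
      using w_act[OF h, of l] l s[OF l] hU by (simp add: f_act)
    then show "ract S (s l) h = rscale S (cocycle A h) (s l)"
      by (rule f_inj) (use l s(1)[OF l] hU in \<open>simp_all add: S.act_closed S.scale_closed\<close>)
  qed
  \<comment> \<open>As [A] generates the orbit module, some element of the group algebra sends it to
    a given nonzero x in \<open>W m\<close>. By uniqueness of components it sends \<open>w m\<close>
    to x and every other \<open>w l\<close> to 0; applied to the relation, it leaves
    \<open>c m\<close> times a nonzero vector.\<close>
  have s_ind: "\<forall>l\<in>?L. c l = 0" if c: "(\<Sum>l\<in>?L. rscale S (c l) (s l)) = 0" for c
  proof
    fix m assume m: "m \<in> ?L"
    have mk: "m < k" using m by simp
    obtain x where x: "x \<in> W m" "x \<noteq> 0"
      using irr[OF mk] right_mod.zero_closed[OF N[OF mk]] unfolding irreducible_module_def by auto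
    have xo: "x D = 0" if "D \<notin> orbit A" for D using sub[OF mk] x that by (auto simp: orbit_module_carrier)
    have "\<exists>u. u \<in> U \<and> D = dot_act n A u" if "D \<in> orbit A" for D using that by (auto simp: orbit_def)
    then obtain u where u: "\<And>D. D \<in> orbit A \<Longrightarrow> u D \<in> U \<and> D = dot_act n A (u D)" by metis
    \<comment> \<open>The division compensates the scalar in [A] u, so that the combination of the
      \<open>u D\<close> with coefficients \<open>y D\<close> takes [A] to x.\<close>
    define y where "y D = x D / cocycle A (u D)" for D
    have xw: "(\<Sum>l<k. \<Sum>D\<in>orbit A. fun_scale (y D) (?act (w l) (u D))) = x"
    proof -
      have "(\<Sum>l<k. \<Sum>D\<in>orbit A. fun_scale (y D) (?act (w l) (u D))) =
        (\<Sum>D\<in>orbit A. \<Sum>l<k. fun_scale (y D) (?act (w l) (u D)))" by (rule sum.swap)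
      also have "\<dots> = (\<Sum>D\<in>orbit A. fun_scale (x D) (basis_elt D))"
      proof (rule sum.cong[OF refl])
        fix D assume D: "D \<in> orbit A"
        have "(\<Sum>l<k. fun_scale (y D) (?act (w l) (u D))) =
          fun_scale (y D) (fun_scale (cocycle A (u D)) (basis_elt (dot_act n A (u D))))"
          using u[OF D] A
          by (simp add: fs.scale_sum_right[symmetric] E_module_act_sum[symmetric] w(2) basis_elt_act)
        also have "\<dots> = fun_scale (x D) (basis_elt D)"
          using u[OF D] cocycle_nonzero[of A "u D"] by (simp add: y_def)
        finally show "(\<Sum>l<k. fun_scale (y D) (?act (w l) (u D))) = fun_scale (x D) (basis_elt D)" .
      qed
      also have "\<dots> = x"
      proof
        fix B
        have "(\<Sum>D\<in>orbit A. fun_scale (x D) (basis_elt D)) B = (\<Sum>D\<in>orbit A. if D = B then x B else 0)"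
          unfolding sum_apply by (intro sum.cong) (auto simp: fun_scale_def basis_elt_def)
        then show "(\<Sum>D\<in>orbit A. fun_scale (x D) (basis_elt D)) B = x B"
          using xo finite_orbit by simp
      qed
      finally show ?thesis .
    qed
    have "(\<Sum>l<k. if l = m then x else 0) = x" using mk by simp
    then have comp: "\<forall>l<k. (\<Sum>D\<in>orbit A. fun_scale (y D) (?act (w l) (u D))) = (if l = m then x else 0)"
      using xw by (intro uniq) (auto simp: N_closed wW u x)
    have z: "(\<Sum>D\<in>orbit A. rscale S (y D) (ract S (s l) (u D))) = (if l = m then inv_into (rcarrier S) (f m) x else 0)"
      if l: "l \<in> ?L" for l
    proof (rule f_inj[OF _ l])
      have 1: "f l (\<Sum>D\<in>orbit A. rscale S (y D) (ract S (s l) (u D))) = (if l = m then x else 0)"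
        using l s[OF l] u comp
        by (subst f_sum) (simp_all add: S.scale_closed S.act_closed f_act[where g="1\<^sub>m n"] one_U f_act(1))
      have 2: "f m (inv_into (rcarrier S) (f m) x) = x" "inv_into (rcarrier S) (f m) x \<in> rcarrier S"
        using bij_betw_imp_surj_on[OF f(1)[OF m]] x(1) by (simp_all add: inv_into_into f_inv_into_f)
      show "f l (\<Sum>D\<in>orbit A. rscale S (y D) (ract S (s l) (u D))) =
          f l (if l = m then inv_into (rcarrier S) (f m) x else 0)"
        using 1 2 f0[OF l] by simp
      show "(\<Sum>D\<in>orbit A. rscale S (y D) (ract S (s l) (u D))) \<in> rcarrier S"
        using s[OF l] u by (intro S.sum_closed S.scale_closed S.act_closed) auto
      show "(if l = m then inv_into (rcarrier S) (f m) x else 0) \<in> rcarrier S"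
        using 2 S.zero_closed by simp
    qed
    let ?t = "inv_into (rcarrier S) (f m) x"
    have "0 = (\<Sum>D\<in>orbit A. rscale S (y D) (ract S (\<Sum>l\<in>?L. rscale S (c l) (s l)) (u D)))"
      using c u by (simp add: S.act_zero)
    also have "\<dots> = (\<Sum>D\<in>orbit A. \<Sum>l\<in>?L. rscale S (c l) (rscale S (y D) (ract S (s l) (u D))))"
    proof (rule sum.cong[OF refl])
      fix D assume D: "D \<in> orbit A"
      show "rscale S (y D) (ract S (\<Sum>l\<in>?L. rscale S (c l) (s l)) (u D)) =
        (\<Sum>l\<in>?L. rscale S (c l) (rscale S (y D) (ract S (s l) (u D))))"
        using u[OF D] s(1)
        by (subst S.act_sum)
          (auto simp: S.scale_closed S.act_scale S.scale_sum_right mult.commute intro!: sum.cong)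
    qed
    also have "\<dots> = (\<Sum>l\<in>?L. \<Sum>D\<in>orbit A. rscale S (c l) (rscale S (y D) (ract S (s l) (u D))))"
      by (rule sum.swap)
    also have "\<dots> = (\<Sum>l\<in>?L. rscale S (c l) (if l = m then ?t else 0))"
      by (intro sum.cong refl) (simp only: S.scale_sum_right[symmetric] z)
    also have "\<dots> = (\<Sum>l\<in>?L. if l = m then rscale S (c m) ?t else 0)"
      by (intro sum.cong) auto
    also have "\<dots> = rscale S (c m) ?t" using m by simp
    finally have "rscale S (c m) ?t = 0" by simp
    moreover have "?t \<noteq> 0"
    proof
      assume "?t = 0"
      moreover have "f m ?t = x"
        using bij_betw_imp_surj_on[OF f(1)[OF m]] x(1) by (simp add: f_inv_into_f)
      ultimately show False using f0[OF m] x by simp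
    qed
    ultimately show "c m = 0" by simp
  qed
  have s_span: "\<exists>c. t = (\<Sum>l\<in>?L. rscale S (c l) (s l))" if t: "t \<in> S.weight_space A" for t
  proof -
    have tS: "t \<in> rcarrier S" using t by (simp add: S.weight_space_def)
    \<comment> \<open>Frobenius reciprocity in coordinates: t u is weighted by the coefficient of
      [A] in x u^-1. The result is a homomorphism to S that sends [A] to |H_A| t, since only the
      stabilizer brings [A] back to a multiple of itself and each of its elements then contributes
      t.\<close>
    define \<phi> where "\<phi> x = (\<Sum>u\<in>U. rscale S (?act x (iv u) A) (ract S t u))" for x
    have \<phi>_sum: "\<phi> (\<Sum>l<k. x l) = (\<Sum>l<k. \<phi> (x l))" for x
      unfolding \<phi>_def
      by (subst sum.swap) (simp add: E_module_act_sum inv_U sum_apply S.scale_sum_left)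
    have hom: "rmod_hom G (?N l) S \<phi>" if l: "l < k" for l
      unfolding rmod_hom_def
    proof (intro conjI ballI allI)
      show "\<phi> ` rcarrier (?N l) \<subseteq> rcarrier S"
        unfolding \<phi>_def using tS by (auto intro!: S.sum_closed S.scale_closed S.act_closed)
    next
      fix v w assume "v \<in> rcarrier (?N l)" "w \<in> rcarrier (?N l)"
      then show "\<phi> (v + w) = \<phi> v + \<phi> w"
        using right_mod.act_add[OF N[OF l], of v w]
        by (simp add: \<phi>_def inv_U S.scale_left_distrib sum.distrib)
    next
      fix c v assume "v \<in> rcarrier (?N l)"
      then show "\<phi> (rscale (?N l) c v) = rscale S c (\<phi> v)"
        using right_mod.act_scale[OF N[OF l], of v]
        by (simp add: \<phi>_def inv_U S.scale_sum_right fun_scale_def)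
    next
      fix v g assume v: "v \<in> rcarrier (?N l)" and g: "g \<in> U"
      have "\<phi> (?act v g) = (\<Sum>u\<in>U. rscale S (?act v (iv (u * iv g)) A) (ract S t u))"
        unfolding \<phi>_def using v g right_mod.act_mult[OF N[OF l], of v g]
        by (intro sum.cong refl) (simp add: inv_U)
      also have "\<dots> = (\<Sum>u\<in>U. rscale S (?act v (iv u) A) (ract S t (u * g)))"
        using sum_U_mult_right[OF g, of "\<lambda>u. rscale S (?act v (iv (u * iv g)) A) (ract S t u)"] g
        by (simp add: mult_inv_cancel)
      also have "\<dots> = ract S (\<phi> v) g"
        unfolding \<phi>_def using tS g S.act_mult[OF tS _ g]
        by (subst S.act_sum) (simp_all add: S.scale_closed S.act_closed S.act_scale)
      finally show "\<phi> (ract (?N l) v g) = ract S (\<phi> v) g" by simp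
    qed
    \<comment> \<open>Schur's lemma on each summand: \<open>\<phi>\<close> composed with the
      isomorphism \<open>f l\<close> is a scalar, and a nonzero value on a summand outside
      \<open>?L\<close> would make that summand isomorphic to S.\<close>
    have comp: "\<exists>c. (l \<in> ?L \<longrightarrow> \<phi> (w l) = rscale S c (s l)) \<and> (l \<notin> ?L \<longrightarrow> \<phi> (w l) = 0)" if l: "l < k" for l
    proof (cases "l \<in> ?L")
      case True
      have "rmod_hom G S S (\<lambda>v. \<phi> (f l v))"
        using f(2)[OF True] hom[OF l] unfolding rmod_hom_def by (auto simp: image_subset_iff)
      then obtain c where c: "\<And>v. v \<in> rcarrier S \<Longrightarrow> \<phi> (f l v) = rscale S c v"
        using schur_scalar[OF S finite_unitriangular] by metis
      show ?thesis using c[OF s(1)[OF True]] s(2)[OF True] True by auto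
    next
      case False
      have "\<phi> (w l) = 0"
      proof (rule ccontr)
        assume nz: "\<phi> (w l) \<noteq> 0"
        have b: "bij_betw \<phi> (W l) (rcarrier S)"
          using irreducible_hom_bij[OF irr[OF l] S hom[OF l], of "w l"] nz wW[OF l] by simp
        let ?g = "inv_into (W l) \<phi>"
        have g: "?g v \<in> W l" "\<phi> (?g v) = v" if "v \<in> rcarrier S" for v
          using bij_betw_imp_surj_on[OF b] that by (simp_all add: inv_into_into f_inv_into_f)
        have g': "?g (\<phi> x) = x" if "x \<in> W l" for x
          using that bij_betw_imp_inj_on[OF b] by simp
        have h: "\<And>x y. x \<in> W l \<Longrightarrow> y \<in> W l \<Longrightarrow> \<phi> (x + y) = \<phi> x + \<phi> y"
          "\<And>c x. x \<in> W l \<Longrightarrow> \<phi> (fun_scale c x) = rscale S c (\<phi> x)"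
          "\<And>x u. x \<in> W l \<Longrightarrow> u \<in> U \<Longrightarrow> \<phi> (?act x u) = ract S (\<phi> x) u"
          using hom[OF l] by (simp_all add: rmod_hom_def)
        have "module_iso G S (?N l)"
          unfolding module_iso_def
        proof (intro exI[of _ ?g] conjI ballI allI)
          show "bij_betw ?g (rcarrier S) (rcarrier (?N l))"
            using bij_betw_inv_into[OF b] by simp
        next
          fix v w assume vw: "v \<in> rcarrier S" "w \<in> rcarrier S"
          have "?g v + ?g w \<in> W l"
            using right_mod.add_closed[OF N[OF l]] g vw by simp
          then show "?g (v + w) = ?g v + ?g w" using g'[of "?g v + ?g w"] h(1) g vw by simp
        next
          fix c v assume v: "v \<in> rcarrier S"
          then show "?g (rscale S c v) = rscale (?N l) c (?g v)"
            using g'[of "fun_scale c (?g v)"] h(2) g N_closed(1)[OF l] by simp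
        next
          fix v u assume v: "v \<in> rcarrier S" "u \<in> U"
          then show "?g (ract S v u) = ract (?N l) (?g v) u"
            using g'[of "?act (?g v) u"] h(3) g N_closed(2)[OF l] by simp
        qed
        then show False using False l by simp
      qed
      then show ?thesis using False by simp
    qed
    then have "\<exists>c. \<forall>l\<in>{..<k}. (l \<in> ?L \<longrightarrow> \<phi> (w l) = rscale S (c l) (s l)) \<and> (l \<notin> ?L \<longrightarrow> \<phi> (w l) = 0)"
      by (intro bchoice ballI) simp
    then obtain c where c: "\<And>l. l < k \<Longrightarrow> l \<in> ?L \<Longrightarrow> \<phi> (w l) = rscale S (c l) (s l)"
        "\<And>l. l < k \<Longrightarrow> l \<notin> ?L \<Longrightarrow> \<phi> (w l) = 0" by blast
    let ?h = "of_nat (card (stabilizer A)) :: complex"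
    have "\<phi> (basis_elt A) = (\<Sum>u\<in>U. if u \<in> stabilizer A then t else 0)"
      unfolding \<phi>_def
    proof (rule sum.cong[OF refl])
      fix u assume u: "u \<in> U"
      have iff: "dot_act n A (iv u) = A \<longleftrightarrow> u \<in> stabilizer A"
        using dot_act_eq_iff[OF A A u] u by (auto simp: stabilizer_def)
      have b: "?act (basis_elt A) (iv u) A = (if u \<in> stabilizer A then cocycle A (iv u) else 0)"
        unfolding basis_elt_act[OF A inv_U(1)[OF u]] iff[symmetric]
        by (auto simp: fun_scale_def basis_elt_def)
      show "rscale S (?act (basis_elt A) (iv u) A) (ract S t u) = (if u \<in> stabilizer A then t else 0)"
      proof (cases "u \<in> stabilizer A")
        case True
        then have "cocycle A (iv u) * cocycle A u = 1"
          using cocycle_inv[OF A u] cocycle_nonzero[of A u] by (simp add: stabilizer_def)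
        then show ?thesis
          using True t unfolding b by (simp add: S.weight_space_def)
      next
        case False
        then show ?thesis
          unfolding b by simp
      qed
    qed
    also have "\<dots> = (\<Sum>u\<in>stabilizer A. t)"
      by (rule sum.mono_neutral_cong_right) (auto simp: finite_unitriangular stabilizer_def)
    also have "\<dots> = rscale S ?h t"
      by (simp add: S.scale_sum_left[symmetric] S.sum_constant_scale)
    finally have "rscale S ?h t = (\<Sum>l<k. \<phi> (w l))"
      by (simp add: w(2)[symmetric] \<phi>_sum)
    also have "\<dots> = (\<Sum>l\<in>?L. rscale S (c l) (s l))"
      by (rule sum.mono_neutral_cong_right) (auto simp: c)
    finally have "rscale S (inverse ?h) (rscale S ?h t) =
        (\<Sum>l\<in>?L. rscale S (inverse ?h * c l) (s l))"
      by (simp add: S.scale_sum_right)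
    moreover have "?h \<noteq> 0" using card_stabilizer_pos[OF A] by simp
    ultimately have "t = (\<Sum>l\<in>?L. rscale S (inverse ?h * c l) (s l))" by simp
    then show ?thesis by (intro exI[of _ "\<lambda>l. inverse ?h * c l"])
  qed
  have IV: "i \<in> V" and wtI: "S.weight_space i = S.weight_space A" if "i \<in> I" for i
    using that I(1) left_orbit_subset[OF A] A by (auto simp: left_orbit_def S.weight_space_lact)
  \<comment> \<open>The scalar by which \<open>F i\<close> after \<open>F_adj i\<close> acts on the
    common weight space.\<close>
  let ?\<kappa> = "\<lambda>i. of_nat (card V) * of_nat (card (stabilizer i)) :: complex"
  have \<kappa>: "?\<kappa> i \<noteq> 0" if "i \<in> I" for i
    using card_stabilizer_pos[OF IV[OF that]] card_V by simp
  have FG: "S.F j (S.F_adj i t) = (if i = j then rscale S (?\<kappa> i) t else 0)"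
    if "i \<in> I" "j \<in> I" "t \<in> S.weight_space A" for i j t
  proof (cases "i = j")
    case True
    then show ?thesis using that IV wtI by (simp add: S.F_F_adj_same)
  next
    case False
    then have "dot_act n i u \<noteq> j" if "u \<in> U" for u
      using I(4) \<open>i \<in> I\<close> \<open>j \<in> I\<close> that by (auto simp: orbit_def)
    moreover have "t \<in> rcarrier S" using that by (simp add: S.weight_space_def)
    ultimately show ?thesis
      using False that IV by (simp add: S.F_F_adj_orthogonal)
  qed
  \<comment> \<open>If \<open>F C x\<close> were nonzero, it would be a psi_C-weight vector, so C
    would lie in the right orbit of some i in I; but \<open>F i x = 0\<close> propagates along that
    orbit. With all \<open>F C x\<close> zero, their sum |V| x is zero.\<close>
  have faith: "x = 0" if x: "x \<in> rcarrier S" "\<And>i. i \<in> I \<Longrightarrow> S.F i x = 0" for x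
  proof -
    have "S.F C x = 0" if C: "C \<in> V" for C
    proof (rule ccontr)
      assume nz: "S.F C x \<noteq> 0"
      have "S.F C x \<in> S.weight_space C" by (rule S.F_in_weight_space[OF x(1) C])
      then obtain z where z: "z \<in> U" "C \<in> orbit (lact z A)"
        using weight_space_in_biorbit[OF S.unitriangular_module_axioms A C emb _ nz] by blast
      then obtain i where i: "i \<in> I" "lact z A \<in> orbit i"
        using I(3) by (auto simp: left_orbit_def)
      then have "C \<in> orbit i" using orbit_eq[OF IV i(2)] z by simp
      then show False
        using S.F_dot_act_eq_0[OF x(1) IV[OF i(1)] _ x(2)[OF i(1)]] nz by (auto simp: orbit_def)
    qed
    then have "rscale S (of_nat (card V)) x = 0" using S.sum_F[OF x(1)] by simp
    then show ?thesis using card_V by simp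
  qed
  have "S.dim (rcarrier S) = card (I \<times> ?L)"
  proof (rule S.dim_eq_card_family[where v="\<lambda>(i, l). S.F_adj i (s l)"])
    show "finite (I \<times> ?L)" using I(2) by simp
    show "S.subspace (rcarrier S)" by (rule S.subspace_carrier)
    show "(case j of (i, l) \<Rightarrow> S.F_adj i (s l)) \<in> rcarrier S" if "j \<in> I \<times> ?L" for j
      using that s(1) by (auto intro: S.F_adj_closed)
  next
    fix c assume "(\<Sum>j\<in>I \<times> ?L. rscale S (c j) (case j of (i, l) \<Rightarrow> S.F_adj i (s l))) = 0"
    then have 0: "(\<Sum>i\<in>I. \<Sum>l\<in>?L. rscale S (c (i, l)) (S.F_adj i (s l))) = 0"
      by (simp add: sum.cartesian_product case_prod_beta)
    \<comment> \<open>Applying \<open>F j\<close> to the relation isolates the terms with i = j and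
      returns a relation between the \<open>s l\<close>.\<close>
    have "c (j, m) = 0" if j: "j \<in> I" and m: "m \<in> ?L" for j m
    proof -
      have "0 = S.F j (\<Sum>i\<in>I. \<Sum>l\<in>?L. rscale S (c (i, l)) (S.F_adj i (s l)))"
        using 0 by (simp add: S.F_zero)
      also have "\<dots> = (\<Sum>i\<in>I. \<Sum>l\<in>?L. S.F j (rscale S (c (i, l)) (S.F_adj i (s l))))"
      proof -
        have cl: "rscale S (c (i, l)) (S.F_adj i (s l)) \<in> rcarrier S" if "l \<in> ?L" for i l
          by (intro S.scale_closed S.F_adj_closed s(1) that)
        have "S.F j (\<Sum>i\<in>I. \<Sum>l\<in>?L. rscale S (c (i, l)) (S.F_adj i (s l))) =
            (\<Sum>i\<in>I. S.F j (\<Sum>l\<in>?L. rscale S (c (i, l)) (S.F_adj i (s l))))"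
          by (rule S.F_sum) (rule S.sum_closed, rule cl)
        also have "\<dots> = (\<Sum>i\<in>I. \<Sum>l\<in>?L. S.F j (rscale S (c (i, l)) (S.F_adj i (s l))))"
          by (rule sum.cong[OF refl], rule S.F_sum, rule cl)
        finally show ?thesis .
      qed
      also have "\<dots> = (\<Sum>i\<in>I. \<Sum>l\<in>?L. rscale S (c (i, l)) (if i = j then rscale S (?\<kappa> i) (s l) else 0))"
        using s(1) s_wt j by (intro sum.cong refl) (simp add: S.F_scale S.F_adj_closed FG)
      also have "\<dots> = (\<Sum>i\<in>I. if i = j then \<Sum>l\<in>?L. rscale S (c (j, l) * ?\<kappa> j) (s l) else 0)"
        by (intro sum.cong refl) (auto intro!: sum.neutral)
      also have "\<dots> = (\<Sum>l\<in>?L. rscale S (c (j, l) * ?\<kappa> j) (s l))" using j I(2) by simp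
      finally have "c (j, m) * ?\<kappa> j = 0" using s_ind[of "\<lambda>l. c (j, l) * ?\<kappa> j"] m by auto
      then show ?thesis using \<kappa>[OF j] by simp
    qed
    then show "\<forall>j\<in>I \<times> ?L. c j = 0" by auto
  next
    fix x assume x: "x \<in> rcarrier S"
    have "\<exists>c. S.F i x = (\<Sum>l\<in>?L. rscale S (c l) (s l))" if "i \<in> I" for i
      using s_span S.F_in_weight_space[OF x IV[OF that]] wtI[OF that] by simp
    then have "\<exists>d. \<forall>i\<in>I. S.F i x = (\<Sum>l\<in>?L. rscale S (d i l) (s l))"
      by (intro bchoice ballI)
    then obtain d where d: "\<And>i. i \<in> I \<Longrightarrow> S.F i x = (\<Sum>l\<in>?L. rscale S (d i l) (s l))" by blast
    define c where "c = (\<lambda>(i, l). inverse (?\<kappa> i) * d i l)"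
    \<comment> \<open>The expansion of x that orthogonality suggests. Each \<open>F j\<close> with j
      in I takes the same value on x and on x', so \<open>faith\<close> applies to the
      difference.\<close>
    define x' where "x' = (\<Sum>i\<in>I. rscale S (inverse (?\<kappa> i)) (S.F_adj i (S.F i x)))"
    have x'S: "x' \<in> rcarrier S"
      unfolding x'_def using x by (intro S.sum_closed S.scale_closed S.F_adj_closed S.F_closed)
    have adj: "S.F_adj i (\<Sum>l\<in>?L. rscale S (b l) (s l)) = (\<Sum>l\<in>?L. rscale S (b l) (S.F_adj i (s l)))" for i b
      by (rule S.F_adj_sum_scale, rule s(1))
    have x'c: "x' = (\<Sum>j\<in>I \<times> ?L. rscale S (c j) (case j of (i, l) \<Rightarrow> S.F_adj i (s l)))"
    proof -
      have "x' = (\<Sum>i\<in>I. \<Sum>l\<in>?L. rscale S (c (i, l)) (S.F_adj i (s l)))"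
        unfolding x'_def c_def
        by (intro sum.cong refl) (simp add: d adj S.scale_sum_right)
      then show ?thesis by (simp add: sum.cartesian_product case_prod_beta)
    qed
    have mx: "- x' \<in> rcarrier S" using S.scale_closed[OF x'S, of "-1"] by simp
    have "x - x' = 0"
    proof (rule faith)
      show "x - x' \<in> rcarrier S" using S.add_closed[OF x mx] by simp
      fix j assume j: "j \<in> I"
      have Fx: "S.F i x \<in> S.weight_space A" "S.F i x \<in> rcarrier S" if "i \<in> I" for i
        using S.F_in_weight_space[OF x IV[OF that]] wtI[OF that] x by (simp_all add: S.F_closed)
      have "S.F j x' = (\<Sum>i\<in>I. rscale S (inverse (?\<kappa> i)) (if i = j then rscale S (?\<kappa> i) (S.F i x) else 0))"
        unfolding x'_def using Fx j
        by (subst S.F_sum) (auto simp: S.F_scale S.F_adj_closed S.scale_closed FG intro!: sum.cong)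
      also have "\<dots> = (\<Sum>i\<in>I. if i = j then S.F j x else 0)"
      proof (rule sum.cong[OF refl])
        fix i assume "i \<in> I"
        then have "inverse (?\<kappa> i) * ?\<kappa> i = 1" by (intro left_inverse \<kappa>)
        then show "rscale S (inverse (?\<kappa> i)) (if i = j then rscale S (?\<kappa> i) (S.F i x) else 0) =
            (if i = j then S.F j x else 0)"
          by (simp only: S.scale_scale S.scale_one S.scale_zero_right split: if_split) auto
      qed
      also have "\<dots> = S.F j x" using j I(2) by simp
      finally have "S.F j x' = S.F j x" .
      moreover have "S.F j (x + rscale S (-1) x') = S.F j x + rscale S (-1) (S.F j x')"
        using x x'S by (simp only: S.F_add S.F_scale S.scale_closed)
      ultimately show "S.F j (x - x') = 0" by simp
    qed
    then show "\<exists>c. x = (\<Sum>j\<in>I \<times> ?L. rscale S (c j) (case j of (i, l) \<Rightarrow> S.F_adj i (s l)))"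
      using x'c by auto
  qed
  then show ?thesis by (simp add: rdim_def card_cartesian_product)
qed

end

section \<open>Orbits of verges\<close>

text \<open>Both orbits of a verge have this shape, with L the set of free positions, so
  intersecting the orbits amounts to intersecting the sets of positions.\<close>

definition perturbations :: "'a mat \<Rightarrow> (nat \<times> nat) set \<Rightarrow> 'a mat set" where
  "perturbations A L = {B \<in> carrier_mat (dim_row A) (dim_col A).
     \<forall>i<dim_row A. \<forall>j<dim_col A. (i, j) \<notin> L \<longrightarrow> B $$ (i, j) = A $$ (i, j)}"

lemma card_perturbations:
  fixes A :: "'a::finite mat"
  assumes L: "L \<subseteq> {..<dim_row A} \<times> {..<dim_col A}"
  shows "card (perturbations A L) = CARD('a) ^ card L"
proof -
  have fin: "finite L" using L by (rule finite_subset) simp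
  have "bij_betw (\<lambda>B. restrict (\<lambda>p. B $$ p) L) (perturbations A L) (L \<rightarrow>\<^sub>E (UNIV :: 'a set))"
  proof (rule bij_betw_byWitness[where
        f'="\<lambda>g. mat (dim_row A) (dim_col A) (\<lambda>p. if p \<in> L then g p else A $$ p)"])
    show "\<forall>B\<in>perturbations A L. mat (dim_row A) (dim_col A)
        (\<lambda>p. if p \<in> L then restrict (\<lambda>p. B $$ p) L p else A $$ p) = B"
      by (auto simp: perturbations_def intro!: eq_matI)
    show "\<forall>g\<in>L \<rightarrow>\<^sub>E UNIV. restrict (\<lambda>p. mat (dim_row A) (dim_col A)
        (\<lambda>p. if p \<in> L then g p else A $$ p) $$ p) L = g"
    proof
      fix g :: "nat \<times> nat \<Rightarrow> 'a" assume g: "g \<in> L \<rightarrow>\<^sub>E UNIV"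
      show "restrict (\<lambda>p. mat (dim_row A) (dim_col A)
          (\<lambda>p. if p \<in> L then g p else A $$ p) $$ p) L = g"
      proof
        fix p
        show "restrict (\<lambda>p. mat (dim_row A) (dim_col A)
            (\<lambda>p. if p \<in> L then g p else A $$ p) $$ p) L p = g p"
        proof (cases "p \<in> L")
          case True
          then have "fst p < dim_row A" "snd p < dim_col A" using L by auto
          then show ?thesis using True by (cases p) simp
        next
          case False
          then show ?thesis using PiE_arb[OF g False] by simp
        qed
      qed
    qed
    show "(\<lambda>g. mat (dim_row A) (dim_col A) (\<lambda>p. if p \<in> L then g p else A $$ p)) `
        (L \<rightarrow>\<^sub>E UNIV) \<subseteq> perturbations A L"
      by (auto simp: perturbations_def)
  qed auto
  then have "card (perturbations A L) = card (L \<rightarrow>\<^sub>E (UNIV :: 'a set))"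
    by (rule bij_betw_same_card)
  also have "\<dots> = CARD('a) ^ card L"
    using fin by (simp add: card_PiE)
  finally show ?thesis .
qed

lemma perturbations_inter: "perturbations A L \<inter> perturbations A R = perturbations A (L \<inter> R)"
  by (auto simp: perturbations_def)

lemma verge_unique:
  assumes "verge A"
  shows "(i, j) \<in> main_conditions A \<Longrightarrow> (i, j') \<in> main_conditions A \<Longrightarrow> j = j'"
    and "(i, j) \<in> main_conditions A \<Longrightarrow> (i', j) \<in> main_conditions A \<Longrightarrow> i = i'"
proof -
  have *: "x = y" if "card {k. k < m \<and> P k} \<le> 1" "x < m" "P x" "y < m" "P y" for x y m :: nat and P
    using card_le_Suc0_iff_eq[of "{k. k < m \<and> P k}"] that by simp
  show "(i, j) \<in> main_conditions A \<Longrightarrow> (i, j') \<in> main_conditions A \<Longrightarrow> j = j'"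
    using assms *[of "dim_col A" "\<lambda>j. A $$ (i, j) \<noteq> 0"]
    by (simp add: verge_def main_conditions_def)
  show "(i, j) \<in> main_conditions A \<Longrightarrow> (i', j) \<in> main_conditions A \<Longrightarrow> i = i'"
    using assms *[of "dim_row A" "\<lambda>i. A $$ (i, j) \<noteq> 0"]
    by (simp add: verge_def main_conditions_def)
qed

text \<open>The legs are taken without the centre of the hook: the entry there is the nonzero entry
  of the verge, which stays fixed along both orbits.\<close>

definition row_legs :: "(nat \<times> nat) set \<Rightarrow> (nat \<times> nat) set" where
  "row_legs P = {(i, k) | i j k. (i, j) \<in> P \<and> j < k \<and> k < i}"

definition col_legs :: "(nat \<times> nat) set \<Rightarrow> (nat \<times> nat) set" where
  "col_legs P = {(l, j) | i j l. (i, j) \<in> P \<and> j < l \<and> l < i}"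

lemma main_conditions_strictly_lower:
  assumes "A \<in> strictly_lower n"
  shows "(i, j) \<in> main_conditions A \<longleftrightarrow> j < i \<and> i < n \<and> A $$ (i, j) \<noteq> 0"
  using assms by (auto simp: main_conditions_def strictly_lower_def not_le[symmetric])

lemma legs_bound:
  assumes "A \<in> strictly_lower n"
  shows "row_legs (main_conditions A) \<subseteq> {..<n} \<times> {..<n}"
    "col_legs (main_conditions A) \<subseteq> {..<n} \<times> {..<n}"
  using assms by (auto simp: row_legs_def col_legs_def main_conditions_strictly_lower)

lemma finite_main_conditions: "finite (main_conditions A)"
  by (rule finite_subset[of _ "{..<dim_row A} \<times> {..<dim_col A}"]) (auto simp: main_conditions_def)

text \<open>Distinct main conditions of a verge lie in distinct columns, so their vertical legs are
  disjoint.\<close>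

lemma card_col_legs:
  assumes A: "A \<in> strictly_lower n" and verge: "verge A"
  shows "card (col_legs (main_conditions A)) = (\<Sum>(i, j)\<in>main_conditions A. i - j - 1)"
proof -
  let ?P = "main_conditions A"
  let ?f = "\<lambda>(i, j). (\<lambda>l. (l, j)) ` {j<..<i}"
  have "col_legs ?P = (\<Union>p\<in>?P. ?f p)" by (auto simp: col_legs_def)
  also have "card \<dots> = (\<Sum>p\<in>?P. card (?f p))"
  proof (rule card_UN_disjoint)
    show "\<forall>p\<in>?P. \<forall>p'\<in>?P. p \<noteq> p' \<longrightarrow> ?f p \<inter> ?f p' = {}"
      using verge_unique(2)[OF verge] by fastforce
  qed (auto simp: finite_main_conditions)
  also have "\<dots> = (\<Sum>(i, j)\<in>?P. i - j - 1)"
    by (intro sum.cong refl) (auto simp: card_image inj_on_def)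
  finally show ?thesis .
qed

text \<open>In a verge, two different hooks share neither their row nor their column, so they cannot
  meet at a centre or along parallel legs. What remains is a horizontal leg of one crossing a
  vertical leg of the other.\<close>

lemma hook_intersections_eq:
  assumes A: "A \<in> strictly_lower n" and verge: "verge A"
  shows "hook_intersections n (main_conditions A) =
    col_legs (main_conditions A) \<inter> row_legs (main_conditions A)"
proof -
  let ?P = "main_conditions A"
  have hk: "x \<in> hook (i, j) \<longleftrightarrow> (fst x = i \<and> j \<le> snd x \<and> snd x < i) \<or> (snd x = j \<and> j < fst x \<and> fst x \<le> i)"
    if "(i, j) \<in> ?P" for x i j
    using that A by (cases x) (auto simp: hook_def main_conditions_strictly_lower)
  have u1: "j = j'" if "(i, j) \<in> ?P" "(i, j') \<in> ?P" for i j j' using verge_unique(1)[OF verge that] .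
  have u2: "i = i'" if "(i, j) \<in> ?P" "(i', j) \<in> ?P" for i i' j using verge_unique(2)[OF verge that] .
  have key: "x \<in> col_legs ?P \<inter> row_legs ?P"
    if p: "(i, j) \<in> ?P" "(r, s) \<in> ?P" "(i, j) \<noteq> (r, s)" and x: "fst x = i" "j \<le> snd x" "snd x < i"
      "snd x = s" "s < fst x" "fst x \<le> r" for i j r s x
  proof -
    have "x = (i, s)" using x by (cases x) auto
    moreover have "j \<noteq> s" using u2[of i j r] p by auto
    moreover have "i \<noteq> r" using u1[of i j s] p by auto
    ultimately show ?thesis using p x by (auto simp: col_legs_def row_legs_def)
  qed
  show ?thesis
  proof
    show "hook_intersections n ?P \<subseteq> col_legs ?P \<inter> row_legs ?P"
    proof
      fix x assume "x \<in> hook_intersections n ?P"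
      then obtain i j r s where p: "(i, j) \<in> ?P" "(r, s) \<in> ?P" "(i, j) \<noteq> (r, s)"
        and x: "x \<in> hook (i, j)" "x \<in> hook (r, s)" by (auto simp: hook_intersections_def)
      show "x \<in> col_legs ?P \<inter> row_legs ?P"
        using x unfolding hk[OF p(1)] hk[OF p(2)]
      proof (elim disjE conjE)
        assume "fst x = i" "fst x = r"
        then show ?thesis using u1[of i j s] p by auto
      next
        assume "snd x = j" "snd x = s"
        then show ?thesis using u2[of i j r] p by auto
      next
        assume "fst x = i" "j \<le> snd x" "snd x < i" "snd x = s" "s < fst x" "fst x \<le> r"
        then show ?thesis using key[OF p] by simp
      next
        assume "snd x = j" "j < fst x" "fst x \<le> i" "fst x = r" "s \<le> snd x" "snd x < r"
        then show ?thesis using key[OF p(2,1) p(3)[symmetric]] by simp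
      qed
    qed
    show "col_legs ?P \<inter> row_legs ?P \<subseteq> hook_intersections n ?P"
    proof
      fix x assume "x \<in> col_legs ?P \<inter> row_legs ?P"
      then obtain i j r s where p: "(i, j) \<in> ?P" "(r, s) \<in> ?P" and x: "x = (i, s)" "j < s" "s < i" "i < r"
        by (auto simp: col_legs_def row_legs_def)
      have "i < n" using p(1) A by (simp add: main_conditions_strictly_lower)
      moreover have "x \<in> hook (i, j)" "x \<in> hook (r, s)"
        unfolding hk[OF p(1)] hk[OF p(2)] using x by auto
      moreover have "(i, j) \<noteq> (r, s)" using x by auto
      ultimately show "x \<in> hook_intersections n ?P"
        using p x unfolding hook_intersections_def Phi_plus_def by blast
    qed
  qed
qed

context unitriangular_character
begin

lemma sum_main_row:
  fixes A :: "'a mat"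
  assumes A: "A \<in> V" and verge: "verge A" and p: "(i, j) \<in> main_conditions A"
  shows "(\<Sum>k<n. A $$ (i, k) * f k) = A $$ (i, j) * f j"
    and "(\<Sum>k<n. f k * A $$ (k, j)) = f i * A $$ (i, j)"
proof -
  have b: "i < n" "j < n" "dim_row A = n" "dim_col A = n"
    using p A by (auto simp: main_conditions_strictly_lower strictly_lower_def main_conditions_def)
  have "(\<Sum>k<n. A $$ (i, k) * f k) = (\<Sum>k\<in>{j}. A $$ (i, k) * f k)"
    using verge_unique(1)[OF verge p] b
    by (intro sum.mono_neutral_right) (auto simp: main_conditions_def)
  then show "(\<Sum>k<n. A $$ (i, k) * f k) = A $$ (i, j) * f j" by simp
  have "(\<Sum>k<n. f k * A $$ (k, j)) = (\<Sum>k\<in>{i}. f k * A $$ (k, j))"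
    using verge_unique(2)[OF verge p] b
    by (intro sum.mono_neutral_right) (auto simp: main_conditions_def)
  then show "(\<Sum>k<n. f k * A $$ (k, j)) = f i * A $$ (i, j)" by simp
qed

text \<open>If (i, j) is the main condition in column j, the entry of \<open>lact x A\<close> at (l,
  j) with j < l is x(i, l) A(i, j). It is free for l < i, equal to A(i, j) for l = i and zero for l
  > i; hence exactly the vertical legs can be filled.\<close>

lemma left_orbit_verge:
  assumes A: "A \<in> V" and verge: "verge A"
  shows "left_orbit A = perturbations A (col_legs (main_conditions A))"
proof -
  let ?P = "main_conditions A"
  have Ac: "A \<in> carrier_mat n n" using A by (rule strictly_lower_carrier_mat)
  note mc = main_conditions_strictly_lower[OF A]
  have ent: "lact x A $$ (l, j) = (if j < l then \<Sum>k<n. x $$ (k, l) * A $$ (k, j) else 0)"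
    if "x \<in> U" "l < n" "j < n" for x l j
  proof -
    have xc: "transpose_mat x \<in> carrier_mat n n" using that by (simp add: UV_carrier_mat)
    have "lact x A $$ (l, j) = (if j < l then (transpose_mat x * A) $$ (l, j) else 0)"
      using that Ac xc by (auto simp: lact_def lower_part_def)
    also have "(transpose_mat x * A) $$ (l, j) = (\<Sum>k<n. x $$ (k, l) * A $$ (k, j))"
      unfolding mult_mat_index[OF xc Ac that(2,3)]
      using that unitriangular_carrier_mat[OF that(1)] by (intro sum.cong) auto
    finally show ?thesis .
  qed
  show ?thesis
  proof
    show "left_orbit A \<subseteq> perturbations A (col_legs ?P)"
    proof
      fix B assume "B \<in> left_orbit A"
      then obtain x where x: "x \<in> U" "B = lact x A" by (auto simp: left_orbit_def)
      have "B $$ (l, j) = A $$ (l, j)" if lj: "l < n" "j < n" "(l, j) \<notin> col_legs ?P" for l j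
      proof (cases "j < l")
        case False
        then show ?thesis using lj x A ent by (simp add: strictly_lower_def)
      next
        case True
        show ?thesis
        proof (cases "\<exists>i. (i, j) \<in> ?P")
          case False
          then have "A $$ (k, j) = 0" if "k < n" for k using that lj Ac by (auto simp: main_conditions_def)
          then show ?thesis using lj x ent by simp
        next
          case ij: True
          then obtain i where i: "(i, j) \<in> ?P" by blast
          then have "i < n" "i \<le> l" using lj True mc by (auto simp: col_legs_def not_less[symmetric])
          have "B $$ (l, j) = x $$ (i, l) * A $$ (i, j)"
            using True lj x ent sum_main_row(2)[OF A verge i, of "\<lambda>k. x $$ (k, l)"] by simp
          also have "\<dots> = A $$ (l, j)"
          proof (cases "i = l")
            case True
            then show ?thesis using x lj by (simp add: unitriangular_iff)
          next
            case False
            then have "(l, j) \<notin> ?P" using verge_unique(2)[OF verge i, of l] by auto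
            then have "A $$ (l, j) = 0" using lj True mc by auto
            moreover have "x $$ (i, l) = 0"
              using x False \<open>i \<le> l\<close> lj by (simp add: unitriangular_iff)
            ultimately show ?thesis by simp
          qed
          finally show ?thesis .
        qed
      qed
      then show "B \<in> perturbations A (col_legs ?P)"
        using Ac x(2) strictly_lower_carrier_mat[OF lact_closed[OF A x(1)]]
        unfolding perturbations_def by auto
    qed
    show "perturbations A (col_legs ?P) \<subseteq> left_orbit A"
    proof
      fix B assume B: "B \<in> perturbations A (col_legs ?P)"
      define c where "c i = (THE j. (i, j) \<in> ?P)" for i
      have c: "c i = j" if "(i, j) \<in> ?P" for i j
        unfolding c_def using that verge_unique(1)[OF verge] by blast
      \<comment> \<open>Row i of x is solved from column \<open>c i\<close> of B. Different main
        conditions use different rows of x, so the prescriptions do not interfere.\<close>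
      define x where "x = mat n n (\<lambda>(i, l). if i = l then 1 else
        if (\<exists>j. (i, j) \<in> ?P \<and> j < l \<and> l < i) then B $$ (l, c i) / A $$ (i, c i) else 0)"
      have x: "x \<in> U" by (auto simp: x_def unitriangular_iff)
      have "B = lact x A"
      proof (rule eq_matI)
        fix l j assume "l < dim_row (lact x A)" "j < dim_col (lact x A)"
        then have lj: "l < n" "j < n"
          using strictly_lower_carrier_mat[OF lact_closed[OF A x]] by auto
        show "B $$ (l, j) = lact x A $$ (l, j)"
        proof (cases "\<exists>i. (i, j) \<in> ?P")
          case False
          then have z: "A $$ (k, j) = 0" if "k < n" for k using that lj Ac by (auto simp: main_conditions_def)
          moreover have "(l, j) \<notin> col_legs ?P" using False by (auto simp: col_legs_def)
          then have "B $$ (l, j) = A $$ (l, j)" using B lj Ac by (auto simp: perturbations_def)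
          ultimately show ?thesis using lj x ent by simp
        next
          case True
          then obtain i where i: "(i, j) \<in> ?P" by blast
          have iA: "j < i" "i < n" "A $$ (i, j) \<noteq> 0" using i mc by auto
          have e: "lact x A $$ (l, j) = (if j < l then x $$ (i, l) * A $$ (i, j) else 0)"
            using lj x ent sum_main_row(2)[OF A verge i, of "\<lambda>k. x $$ (k, l)"] by simp
          show ?thesis
          proof (cases "j < l \<and> l < i")
            case True
            then have "x $$ (i, l) = B $$ (l, j) / A $$ (i, j)"
              using i lj iA c[OF i] by (auto simp: x_def)
            then show ?thesis using e True iA by simp
          next
            case False
            have "(l, j) \<notin> col_legs ?P"
              using False verge_unique(2)[OF verge i] by (auto simp: col_legs_def)
            then have Bl: "B $$ (l, j) = A $$ (l, j)" using B lj Ac by (auto simp: perturbations_def)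
            show ?thesis
            proof (cases "l = i")
              case True
              then show ?thesis using e Bl iA lj by (simp add: x_def)
            next
              case li: False
              then have "(l, j) \<notin> ?P" using verge_unique(2)[OF verge i, of l] by auto
              then have "A $$ (l, j) = 0" using lj Ac by (auto simp: main_conditions_def)
              moreover have "j < l \<Longrightarrow> x $$ (i, l) = 0"
                using False li x lj iA by (auto simp: unitriangular_iff)
              ultimately show ?thesis using e Bl by simp
            qed
          qed
        qed
      qed (use B Ac strictly_lower_carrier_mat[OF lact_closed[OF A x]] in \<open>auto simp: perturbations_def\<close>)
      then show "B \<in> left_orbit A" using x by (auto simp: left_orbit_def)
    qed
  qed
qed

text \<open>If (i, j) is the main condition in row i, the entry of A x^t at (i, l) is A(i, j) x(l,
  j), free for l > j, and the truncation keeps l < i. Hence exactly the horizontal legs can be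
  filled.\<close>

lemma orbit_verge:
  assumes A: "A \<in> V" and verge: "verge A"
  shows "orbit A = perturbations A (row_legs (main_conditions A))"
proof -
  let ?P = "main_conditions A"
  have Ac: "A \<in> carrier_mat n n" using A by (rule strictly_lower_carrier_mat)
  note mc = main_conditions_strictly_lower[OF A]
  let ?B = "\<lambda>x. lower_part (A * transpose_mat x)"
  \<comment> \<open>Inversion permutes U, so x may run over U in place of u^-1.\<close>
  have orb: "orbit A = ?B ` U"
  proof
    show "orbit A \<subseteq> ?B ` U" by (auto simp: orbit_def dot_act_def inv_U)
    show "?B ` U \<subseteq> orbit A"
    proof
      fix C assume "C \<in> ?B ` U"
      then obtain x where "x \<in> U" "C = ?B x" by blast
      then have "C = dot_act n A (iv x)" "iv x \<in> U" by (simp_all add: dot_act_def inv_U)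
      then show "C \<in> orbit A" by (auto simp: orbit_def)
    qed
  qed
  have Bc: "?B x \<in> carrier_mat n n" if "x \<in> U" for x
    using Ac unitriangular_carrier_mat[OF that] by (auto simp: lower_part_def)
  have ent: "?B x $$ (i, l) = (if l < i then \<Sum>k<n. A $$ (i, k) * x $$ (l, k) else 0)"
    if "x \<in> U" "i < n" "l < n" for x l i
  proof -
    have xc: "transpose_mat x \<in> carrier_mat n n" using that by (simp add: UV_carrier_mat)
    have "?B x $$ (i, l) = (if l < i then (A * transpose_mat x) $$ (i, l) else 0)"
      using that Ac xc by (auto simp: lower_part_def)
    also have "(A * transpose_mat x) $$ (i, l) = (\<Sum>k<n. A $$ (i, k) * x $$ (l, k))"
      unfolding mult_mat_index[OF Ac xc that(2,3)]
      using that unitriangular_carrier_mat[OF that(1)] by (intro sum.cong) auto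
    finally show ?thesis .
  qed
  show ?thesis
  proof
    show "orbit A \<subseteq> perturbations A (row_legs ?P)"
    proof
      fix B assume "B \<in> orbit A"
      then obtain x where x: "x \<in> U" "B = ?B x" by (auto simp: orb)
      have "B $$ (i, l) = A $$ (i, l)" if lj: "i < n" "l < n" "(i, l) \<notin> row_legs ?P" for i l
      proof (cases "l < i")
        case False
        then show ?thesis using lj x A ent by (simp add: strictly_lower_def)
      next
        case True
        show ?thesis
        proof (cases "\<exists>j. (i, j) \<in> ?P")
          case False
          then have "A $$ (i, k) = 0" if "k < n" for k using that lj Ac by (auto simp: main_conditions_def)
          then show ?thesis using lj x ent by simp
        next
          case ij: True
          then obtain j where j: "(i, j) \<in> ?P" by blast
          then have "l \<le> j" "j < n" using lj True mc by (force simp: row_legs_def not_less[symmetric])+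
          have "B $$ (i, l) = A $$ (i, j) * x $$ (l, j)"
            using True lj x ent sum_main_row(1)[OF A verge j, of "\<lambda>k. x $$ (l, k)"] by simp
          also have "\<dots> = A $$ (i, l)"
          proof (cases "j = l")
            case True
            then show ?thesis using x lj by (simp add: unitriangular_iff)
          next
            case False
            then have "(i, l) \<notin> ?P" using verge_unique(1)[OF verge j, of l] by auto
            then have "A $$ (i, l) = 0" using lj True mc by auto
            moreover have "x $$ (l, j) = 0"
              using x False \<open>l \<le> j\<close> \<open>j < n\<close> lj by (simp add: unitriangular_iff)
            ultimately show ?thesis by simp
          qed
          finally show ?thesis .
        qed
      qed
      then show "B \<in> perturbations A (row_legs ?P)"
        using Ac x Bc[OF x(1)] by (auto simp: perturbations_def)
    qed
    show "perturbations A (row_legs ?P) \<subseteq> orbit A"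
    proof
      fix B assume B: "B \<in> perturbations A (row_legs ?P)"
      define r where "r j = (THE i. (i, j) \<in> ?P)" for j
      have r: "r j = i" if "(i, j) \<in> ?P" for i j
        unfolding r_def using that verge_unique(2)[OF verge] by blast
      \<comment> \<open>Column j of x is solved from row \<open>r j\<close> of B; different main
        conditions use different columns of x.\<close>
      define x where "x = mat n n (\<lambda>(l, j). if l = j then 1 else
        if (\<exists>i. (i, j) \<in> ?P \<and> j < l \<and> l < i) then B $$ (r j, l) / A $$ (r j, j) else 0)"
      have x: "x \<in> U" by (auto simp: x_def unitriangular_iff)
      have "B = ?B x"
      proof (rule eq_matI)
        fix i l assume "i < dim_row (?B x)" "l < dim_col (?B x)"
        then have lj: "i < n" "l < n" using Bc[OF x] by auto
        show "B $$ (i, l) = ?B x $$ (i, l)"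
        proof (cases "\<exists>j. (i, j) \<in> ?P")
          case False
          then have z: "A $$ (i, k) = 0" if "k < n" for k using that lj Ac by (auto simp: main_conditions_def)
          moreover have "(i, l) \<notin> row_legs ?P" using False by (auto simp: row_legs_def)
          then have "B $$ (i, l) = A $$ (i, l)" using B lj Ac by (auto simp: perturbations_def)
          ultimately show ?thesis using lj x ent by simp
        next
          case True
          then obtain j where j: "(i, j) \<in> ?P" by blast
          have iA: "j < i" "j < n" "A $$ (i, j) \<noteq> 0" using j mc lj by auto
          have e: "?B x $$ (i, l) = (if l < i then A $$ (i, j) * x $$ (l, j) else 0)"
            using lj x ent sum_main_row(1)[OF A verge j, of "\<lambda>k. x $$ (l, k)"] by simp
          show ?thesis
          proof (cases "j < l \<and> l < i")
            case True
            then have "x $$ (l, j) = B $$ (i, l) / A $$ (i, j)"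
              using j lj iA r[OF j] by (auto simp: x_def)
            then show ?thesis using e True iA by simp
          next
            case False
            have "(i, l) \<notin> row_legs ?P"
              using False verge_unique(1)[OF verge j] by (auto simp: row_legs_def)
            then have Bl: "B $$ (i, l) = A $$ (i, l)" using B lj Ac by (auto simp: perturbations_def)
            show ?thesis
            proof (cases "l = j")
              case True
              then show ?thesis using e Bl iA lj by (simp add: x_def)
            next
              case li: False
              then have "(i, l) \<notin> ?P" using verge_unique(1)[OF verge j, of l] by auto
              then have "A $$ (i, l) = 0" using lj Ac by (auto simp: main_conditions_def)
              moreover have "l < i \<Longrightarrow> x $$ (l, j) = 0"
                using False li x lj iA by (auto simp: unitriangular_iff)
              ultimately show ?thesis using e Bl by simp
            qed
          qed
        qed
      qed (use B Ac Bc[OF x] in \<open>auto simp: perturbations_def\<close>)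
      then show "B \<in> orbit A" using x by (auto simp: orb)
    qed
  qed
qed

text \<open>The free positions of the intersection are those common to a vertical and a horizontal
  leg, which are the hook intersections.\<close>

lemma card_orbits_verge:
  assumes A: "A \<in> V" and verge: "verge A"
  shows "card (left_orbit A) = CARD('a) ^ (\<Sum>(i, j)\<in>main_conditions A. i - j - 1)"
    and "card (left_orbit A \<inter> orbit A) = CARD('a) ^ card (hook_intersections n (main_conditions A))"
proof -
  have "dim_row A = n" "dim_col A = n" using A by (auto simp: strictly_lower_def)
  then show "card (left_orbit A) = CARD('a) ^ (\<Sum>(i, j)\<in>main_conditions A. i - j - 1)"
    "card (left_orbit A \<inter> orbit A) = CARD('a) ^ card (hook_intersections n (main_conditions A))"
    using legs_bound[OF A] unfolding left_orbit_verge[OF A verge] orbit_verge[OF A verge] perturbations_inter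
      card_col_legs[OF A verge, symmetric] hook_intersections_eq[OF A verge]
    by (subst card_perturbations; auto)+
qed

end

section \<open>The lower bound and the multiplicity\<close>

theorem theorem3p9:
  fixes n a b q :: nat
    and \<theta> :: "'a::{field, finite} \<Rightarrow> complex"
    and A :: "'a mat"
    and S :: "('a mat, 's::ab_group_add) rmod"
  assumes "q = CARD('a)"
    and "nontrivial_character \<theta>"
    and "A \<in> strictly_lower n"
    and "verge A"
    and "a = (\<Sum>(i, j)\<in>main_conditions A. i - j - 1)"
    and "b = card (hook_intersections n (main_conditions A))"
    and "irreducible_constituent (unitriangular_group n) S (orbit_module n \<theta> A)"
  shows "real (rdim S) \<ge> real q powi (int a - int b) \<and>
    (\<forall>m::nat. real (rdim S) = real q powi (int a - int b + int m) \<longrightarrow>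
       multiplicity_in (unitriangular_group n) S (orbit_module n \<theta> A) = q ^ m)"
proof -
  interpret unitriangular_character n \<theta> by unfold_locales fact
  let ?M = "orbit_module n \<theta> A"
  let ?mult = "\<lambda>k W. card {l. l < k \<and> module_iso G S (?M\<lparr>rcarrier := W l\<rparr>)}"
  have A: "A \<in> V" by fact
  obtain I where I: "I \<subseteq> left_orbit A" "finite I"
      "\<And>B. B \<in> left_orbit A \<Longrightarrow> \<exists>C\<in>I. B \<in> orbit C"
      "\<And>B C. B \<in> I \<Longrightarrow> C \<in> I \<Longrightarrow> C \<in> orbit B \<Longrightarrow> B = C"
      "card I * card (left_orbit A \<inter> orbit A) = card (left_orbit A)"
    using orbit_transversal[OF A] by metis
  have q: "q > 0" using assms(1) by simp
  have "card I * q ^ b = q ^ a"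
    using I(5) card_orbits_verge[OF A assms(4)] assms(1,5,6) by simp
  then have "real (card I) * real q ^ b = real q ^ a" by (metis of_nat_mult of_nat_power)
  then have N: "real (card I) = real q powi (int a - int b)"
    using q by (simp add: power_int_diff field_simps)
  obtain k W l where irr: "irreducible_module G S" and dec: "decomposition G ?M k W"
    and l: "l < k" "module_iso G S (?M\<lparr>rcarrier := W l\<rparr>)"
    using assms(7) by (auto simp: irreducible_constituent_def)
  obtain e where e: "bij_betw e (rcarrier S) (rcarrier (?M\<lparr>rcarrier := W l\<rparr>))"
        "\<forall>v\<in>rcarrier S. \<forall>w\<in>rcarrier S. e (v + w) = e v + e w"
        "\<forall>c. \<forall>v\<in>rcarrier S. e (rscale S c v) = rscale (?M\<lparr>rcarrier := W l\<rparr>) c (e v)"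
        "\<forall>v\<in>rcarrier S. \<forall>g\<in>U. e (ract S v g) = ract (?M\<lparr>rcarrier := W l\<rparr>) (e v) g"
    using l(2) unfolding module_iso_def by blast
  have "W l \<subseteq> rcarrier ?M" using dec l(1) by (simp add: decomposition_def submodule_on_def)
  then have "rmod_hom G S ?M e"
    using e bij_betw_imp_surj_on[OF e(1)] by (auto simp: rmod_hom_def)
  note dim = rdim_eq_card_mult[OF A irr this bij_betw_imp_inj_on[OF e(1)] _ I(1-4)]
  have N0: "card I \<noteq> 0" using N q zero_less_power_int[of "real q" "int a - int b"] by linarith
  \<comment> \<open>Every decomposition yields the dimension of S with the same nonzero factor
    \<open>card I\<close>, so all decompositions contain equally many copies of S.\<close>
  have mult: "multiplicity_in G S ?M = ?mult k W"
    unfolding multiplicity_in_def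
  proof (rule the_equality)
    show "\<exists>k' W'. decomposition G ?M k' W' \<and> ?mult k W = ?mult k' W'" using dec by blast
    fix r assume "\<exists>k' W'. decomposition G ?M k' W' \<and> r = ?mult k' W'"
    then obtain k' W' where W': "decomposition G ?M k' W'" "r = ?mult k' W'" by blast
    have "card I * ?mult k' W' = card I * ?mult k W" 
      by (rule trans[OF dim[OF W'(1), symmetric] dim[OF dec]])
    then show "r = ?mult k W" using W'(2) N0 by simp
  qed
  have dimS: "real (rdim S) = real q powi (int a - int b) * real (multiplicity_in G S ?M)"
    using dim[OF dec] N by (simp add: mult)
  \<comment> \<open>The summand \<open>W l\<close> that exhibits S as a constituent is counted, so
    the multiplicity is at least 1 and the bound follows from the dimension formula.\<close>
  have "?mult k W > 0" using l by (auto simp: card_gt_0_iff)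
  then have "real (multiplicity_in G S ?M) \<ge> 1" by (simp add: mult)
  then have "real (rdim S) \<ge> real q powi (int a - int b)"
    unfolding dimS using mult_left_mono[of 1 _ "real q powi (int a - int b)"] q
    by (simp add: zero_le_power_int)
  moreover have "multiplicity_in G S ?M = q ^ m"
    if "real (rdim S) = real q powi (int a - int b + int m)" for m
  proof -
    have "real q powi (int a - int b) * real (multiplicity_in G S ?M) =
        real q powi (int a - int b) * real q ^ m"
      using that q unfolding dimS by (simp add: power_int_add)
    then have "real (multiplicity_in G S ?M) = real (q ^ m)" using q by simp
    then show ?thesis by (simp only: of_nat_eq_iff)
  qed
  ultimately show ?thesis by blast
qed

end
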